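(* Let $G$ be a graph, $\mathcal C$ a hole cover of $G$, $(\mathcal C_1,\dots,\mathcal C_{i(G)})$ a local chordalization partition of $\mathcal C$ with exactly $i(G)$ parts, and $G^*$ the last graph of the corresponding chordalization chain (with $G^*=G$ if $G$ is chordal). Then for every induced subgraph $H$ of $G$, $\omega(H^* )\le\omega(H)+i(G)$, where $H^*$ is the subgraph of $G^*$ induced by $V(H)$. Moreover, if $G$ is non-chordal and $K_n$-minor-free, then $\omega(G^* )\le n-2+i(G)$.
   Context: All graphs are finite and simple; $\omega$ is the clique number. A hole of $G$ is an induced cycle of length at least $4$; $G$ is chordal if it has no hole. $\mathcal H(G)$ is the set of holes and $\mathcal H(G,u)$ those containing $u$. A hole cover of $G$ is a nonempty $X\subseteq V(G)$ meeting every hole (any nonempty set if $G$ is chordal). A vertex $u$ satisfies the NC property in $G$ if there are no holes $H\in\mathcal H(G,u)$, $H'\in\mathcal H(G)\setminus\mathcal H(G,u)$ sharing two consecutive edges (two distinct edges with a common end vertex lying on both). A set $\mathcal C$ satisfies the NC property in $G$ if each of its vertices does and every hole contains at most one vertex of $\mathcal C$. Locally chordalizing all holes in $\mathcal H(G,u)$ by $u$ means adding all edges $uw$ with $w\ne u$ lying on some hole in $\mathcal H(G,u)$. For a hole cover $\mathcal C=\{u_1,\dots,u_k\}$ satisfying the NC property in $G$, set $G_0=G$, obtain $G_i$ from $G_{i-1}$ by locally chordalizing all holes in $\mathcal H(G_{i-1},u_i)$ by $u_i$, and put $\widehat G(\mathcal C)=G_k$ (independent of the ordering). Given a hole cover $\mathcal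 C$ of $G$, an ordered partition $(\mathcal C_1,\dots,\mathcal C_\ell)$ of $\mathcal C$ into nonempty parts is a local chordalization partition if, with $G_0=G_0^*=G-\mathcal C$ and, for $i=1,\dots,\ell$, $G_i$ the graph with $V(G_i)=V(G_{i-1}^* )\cup\mathcal C_i$ and $E(G_i)=E(G_{i-1}^* )\cup E\big(G-\bigcup_{j=i+1}^{\ell}\mathcal C_j\big)$ and $G_i^*=\widehat{G_i}(\mathcal C_i)$, each $\mathcal C_i$ is a hole cover of $G_i$ satisfying the NC property in $G_i$ and each $G_i^*$ is chordal; the sequence $G_0,G_0^*,\dots,G_\ell,G_\ell^*$ is the chordalization chain. The non-chordality index $i(G)$ is $0$ if $G$ is chordal and otherwise the smallest $\ell$ such that some hole cover of $G$ admits a local chordalization partition with $\ell$ parts. *)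

theory Defs
  imports Main
begin

text \<open>A (finite, simple) graph is a pair (vertex set, edge set), edges being 2-element
  vertex sets.\<close>
type_synonym 'a graph = "'a set \<times> 'a set set"

definition verts :: "'a graph \<Rightarrow> 'a set" where "verts G = fst G"
definition edges :: "'a graph \<Rightarrow> 'a set set" where "edges G = snd G"

definition graph :: "'a graph \<Rightarrow> bool" where
  "graph G \<longleftrightarrow> finite (verts G) \<and>
     (\<forall>e\<in>edges G. \<exists>u v. u \<noteq> v \<and> u \<in> verts G \<and> v \<in> verts G \<and> e = {u, v})"

definition adj :: "'a graph \<Rightarrow> 'a \<Rightarrow> 'a \<Rightarrow> bool" where
  "adj G u v \<longleftrightarrow> u \<noteq> v \<and> {u, v} \<in> edges G"

text \<open>Induced subgraph on S, and deletion of a vertex set X.\<close>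
definition induced :: "'a graph \<Rightarrow> 'a set \<Rightarrow> 'a graph" where
  "induced G S = (verts G \<inter> S, {e \<in> edges G. e \<subseteq> S})"

definition delete :: "'a graph \<Rightarrow> 'a set \<Rightarrow> 'a graph" where
  "delete G X = induced G (verts G - X)"

text \<open>Clique number.\<close>
definition clique :: "'a graph \<Rightarrow> 'a set \<Rightarrow> bool" where
  "clique G K \<longleftrightarrow> K \<subseteq> verts G \<and> (\<forall>x\<in>K. \<forall>y\<in>K. x \<noteq> y \<longrightarrow> adj G x y)"

definition omega :: "'a graph \<Rightarrow> nat" where
  "omega G = Max (card ` {K. clique G K})"

text \<open>A hole (induced cycle of length at least 4), identified with its vertex set:
  its vertices can be listed cyclically so that two of them are adjacent in G
  exactly when they are cyclically consecutive.\<close>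
definition is_hole :: "'a graph \<Rightarrow> 'a set \<Rightarrow> bool" where
  "is_hole G H \<longleftrightarrow> H \<subseteq> verts G \<and>
     (\<exists>xs. distinct xs \<and> set xs = H \<and> length xs \<ge> 4 \<and>
        (\<forall>i<length xs. \<forall>j<length xs.
            adj G (xs ! i) (xs ! j) \<longleftrightarrow>
              (j = Suc i mod length xs \<or> i = Suc j mod length xs)))"

definition chordal :: "'a graph \<Rightarrow> bool" where
  "chordal G \<longleftrightarrow> \<not> (\<exists>H. is_hole G H)"

definition hole_cover :: "'a graph \<Rightarrow> 'a set \<Rightarrow> bool" where
  "hole_cover G X \<longleftrightarrow> X \<noteq> {} \<and> X \<subseteq> verts G \<and> (\<forall>H. is_hole G H \<longrightarrow> H \<inter> X \<noteq> {})"

text \<open>Since holes are induced, the edges of a hole H are the edges of G inside H; two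
  holes share two consecutive edges xy, yz iff x,y,z distinct lie in both and
  xy, yz are edges of G.\<close>
definition nc_vertex :: "'a graph \<Rightarrow> 'a \<Rightarrow> bool" where
  "nc_vertex G u \<longleftrightarrow> \<not> (\<exists>H H' x y z. is_hole G H \<and> u \<in> H \<and> is_hole G H' \<and> u \<notin> H' \<and>
       x \<noteq> z \<and> x \<in> H \<inter> H' \<and> y \<in> H \<inter> H' \<and> z \<in> H \<inter> H' \<and> adj G x y \<and> adj G y z)"

definition nc_set :: "'a graph \<Rightarrow> 'a set \<Rightarrow> bool" where
  "nc_set G C \<longleftrightarrow> (\<forall>u\<in>C. nc_vertex G u) \<and> (\<forall>H. is_hole G H \<longrightarrow> card (H \<inter> C) \<le> 1)"

text \<open>Locally chordalizing all holes through u by u.\<close>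
definition loc_chord :: "'a graph \<Rightarrow> 'a \<Rightarrow> 'a graph" where
  "loc_chord G u = (verts G,
     edges G \<union> {{u, w} | w. w \<noteq> u \<and> (\<exists>H. is_hole G H \<and> u \<in> H \<and> w \<in> H)})"

fun chord_seq :: "'a graph \<Rightarrow> 'a list \<Rightarrow> 'a graph" where
  "chord_seq G [] = G"
| "chord_seq G (u # us) = chord_seq (loc_chord G u) us"

text \<open>\<open>G^(C)\<close>: chordalize along some enumeration of C (the paper shows the result
  does not depend on the ordering).\<close>
definition hat :: "'a graph \<Rightarrow> 'a set \<Rightarrow> 'a graph" where
  "hat G C = chord_seq G (SOME xs. distinct xs \<and> set xs = C)"

text \<open>Chordalization chain for the ordered partition Cs = [C_1,...,C_l] (0-indexed list):
  chain G Cs i = (G_i, G_i^*).\<close>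
fun chain :: "'a graph \<Rightarrow> 'a set list \<Rightarrow> nat \<Rightarrow> 'a graph \<times> 'a graph" where
  "chain G Cs 0 = (delete G (\<Union>(set Cs)), delete G (\<Union>(set Cs)))"
| "chain G Cs (Suc i) =
     (let S = snd (chain G Cs i);
          Gi = (verts S \<union> Cs ! i,
                edges S \<union> edges (delete G (\<Union>(set (drop (Suc i) Cs)))))
      in (Gi, hat Gi (Cs ! i)))"

definition local_chord_partition :: "'a graph \<Rightarrow> 'a set \<Rightarrow> 'a set list \<Rightarrow> bool" where
  "local_chord_partition G C Cs \<longleftrightarrow>
     hole_cover G C \<and> \<Union>(set Cs) = C \<and>
     (\<forall>i<length Cs. Cs ! i \<noteq> {}) \<and>
     (\<forall>i<length Cs. \<forall>j<length Cs. i \<noteq> j \<longrightarrow> Cs ! i \<inter> Cs ! j = {}) \<and>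
     (\<forall>i<length Cs. hole_cover (fst (chain G Cs (Suc i))) (Cs ! i) \<and>
                     nc_set (fst (chain G Cs (Suc i))) (Cs ! i) \<and>
                     chordal (snd (chain G Cs (Suc i))))"

text \<open>Non-chordality index.\<close>
definition nci :: "'a graph \<Rightarrow> nat" where
  "nci G = (if chordal G then 0
            else (LEAST l. \<exists>C Cs. local_chord_partition G C Cs \<and> length Cs = l))"

text \<open>K_n minor via branch sets: n pairwise disjoint nonempty connected vertex sets,
  pairwise joined by an edge.\<close>
definition connected_set :: "'a graph \<Rightarrow> 'a set \<Rightarrow> bool" where
  "connected_set G S \<longleftrightarrow>
     (\<forall>x\<in>S. \<forall>y\<in>S. (x, y) \<in> {(a, b). a \<in> S \<and> b \<in> S \<and> adj G a b}\<^sup>*)"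

definition has_complete_minor :: "'a graph \<Rightarrow> nat \<Rightarrow> bool" where
  "has_complete_minor G n \<longleftrightarrow>
     (\<exists>B :: nat \<Rightarrow> 'a set.
        (\<forall>i<n. B i \<noteq> {} \<and> B i \<subseteq> verts G \<and> connected_set G (B i)) \<and>
        (\<forall>i<n. \<forall>j<n. i \<noteq> j \<longrightarrow> B i \<inter> B j = {} \<and> (\<exists>x\<in>B i. \<exists>y\<in>B j. adj G x y)))"

end

theory Submission
  imports Defs
begin

text \<open>
  If \<open>u\<close> satisfies the NC property, then locally chordalizing by \<open>u\<close> destroys the holes through
  \<open>u\<close> and creates none: a new hole would supply a path that leaves a hole through \<open>u\<close> and returns
  to the neighbourhood of \<open>u\<close>, and rerouting old holes along it yields either a hole through
  \<open>u\<close> and a vertex of the path, or a hole avoiding \<open>u\<close> that shares two consecutive edges with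
  a hole through \<open>u\<close>. Hence the new edges of \<open>hat G C\<close> are exactly the nonadjacent pairs
  \<open>u, w\<close> with \<open>u \<in> C\<close> on a common hole of \<open>G\<close>.

  Within a clique of \<open>hat G C\<close> all new edges have the same end \<open>u \<in> C\<close>: two different ends
  \<open>u, u'\<close> are adjacent in \<open>G\<close> and would lie on a common 4-cycle, or some vertex would be joined
  to both by new edges, which the NC property excludes. So each stage of the chain costs at most
  one vertex of a clique, which gives the first bound.

  The holes of the first stage are holes of \<open>G\<close>. There the vertex need not be deleted: arcs of
  the holes that join it to its nonneighbours in the clique form, together with it, a branch set
  of a complete minor of \<open>G\<close>. This saves one in the second bound.
\<close>


lemma adj_sym: "adj G x y \<longleftrightarrow> adj G y x"
  by (auto simp: adj_def insert_commute)

lemma adj_irrefl [simp]: "\<not> adj G x x"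
  by (simp add: adj_def)

lemma adj_in_verts: "graph G \<Longrightarrow> adj G x y \<Longrightarrow> x \<in> verts G \<and> y \<in> verts G"
  unfolding graph_def adj_def by (metis doubleton_eq_iff)

section \<open>Induced paths and holes\<close>

text \<open>Lists the vertices of an induced path from one end. The recursion fits cutting and
  splicing; \<open>ipath_nth\<close> gives the index form that matches
  \<open>is_hole\<close>.\<close>

fun ipath :: "'a graph \<Rightarrow> 'a list \<Rightarrow> bool" where
  "ipath G [] \<longleftrightarrow> True"
| "ipath G (x # xs) \<longleftrightarrow> x \<in> verts G \<and> x \<notin> set xs \<and> ipath G xs \<and>
     (\<forall>y\<in>set xs. adj G x y \<longleftrightarrow> y = hd xs)"

text \<open>The tool for cutting and splicing induced paths. If a piece is empty, the quantifier
  over it is empty, so the unspecified \<open>last []\<close> and \<open>hd []\<close> do no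
  harm.\<close>

lemma ipath_append:
  "ipath G (xs @ ys) \<longleftrightarrow> ipath G xs \<and> ipath G ys \<and> set xs \<inter> set ys = {} \<and>
     (\<forall>x\<in>set xs. \<forall>y\<in>set ys. adj G x y \<longleftrightarrow> x = last xs \<and> y = hd ys)"
proof (induction xs)
  case Nil
  then show ?case by simp
next
  case (Cons x xs)
  show ?case
  proof (cases "xs = []")
    case True
    then show ?thesis by (auto simp: Int_commute)
  next
    case False
    define P where "P \<longleftrightarrow> (\<forall>a\<in>set xs. \<forall>y\<in>set ys. adj G a y \<longleftrightarrow> a = last xs \<and> y = hd ys)"
    have hl: "hd xs \<in> set xs" "last xs \<in> set xs"
      using False by auto
    have "ipath G (xs @ ys) \<longleftrightarrow> ipath G xs \<and> ipath G ys \<and> set xs \<inter> set ys = {} \<and> P"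
      using Cons unfolding P_def .
    moreover have "(\<forall>a\<in>set (x # xs). \<forall>y\<in>set ys. adj G a y \<longleftrightarrow> a = last (x # xs) \<and> y = hd ys) \<longleftrightarrow>
        P \<and> (\<forall>y\<in>set ys. \<not> adj G x y)" if "x \<notin> set xs"
    proof -
      have "last (x # xs) = last xs" "x \<noteq> last xs"
        using False that hl by auto
      then show ?thesis
        unfolding P_def by simp blast
    qed
    moreover have "(\<forall>y\<in>set (xs @ ys). adj G x y \<longleftrightarrow> y = hd (xs @ ys)) \<longleftrightarrow>
        (\<forall>y\<in>set xs. adj G x y \<longleftrightarrow> y = hd xs) \<and> (\<forall>y\<in>set ys. \<not> adj G x y)"
      if "set xs \<inter> set ys = {}"
    proof -
      have "hd xs \<notin> set ys" using that hl by blast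
      then show ?thesis using False by auto
    qed
    ultimately show ?thesis
      by auto
  qed
qed

lemma ipath_rev [simp]: "ipath G (rev xs) \<longleftrightarrow> ipath G xs"
proof (induction xs)
  case Nil
  then show ?case by simp
next
  case (Cons x xs)
  then show ?case
    by (cases xs) (auto simp: ipath_append last_rev adj_sym[of G _ x])
qed

lemma ipath_verts: "ipath G xs \<Longrightarrow> set xs \<subseteq> verts G"
  by (induction xs) auto

lemma ipath_nth:
  "ipath G xs \<longleftrightarrow> set xs \<subseteq> verts G \<and> distinct xs \<and>
     (\<forall>i<length xs. \<forall>j<length xs. adj G (xs ! i) (xs ! j) \<longleftrightarrow> j = Suc i \<or> i = Suc j)"
proof (induction xs)
  case Nil
  then show ?case by simp
next
  case (Cons x xs)
  show ?case
  proof (cases "xs = []")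
    case False
    have *: "(\<forall>y\<in>set xs. adj G x y \<longleftrightarrow> y = hd xs) \<longleftrightarrow>
        (\<forall>j<length xs. adj G x (xs ! j) \<longleftrightarrow> j = 0)" if "distinct xs"
      using that False by (simp add: all_set_conv_all_nth hd_conv_nth nth_eq_iff_index_eq)
    show ?thesis
      using Cons * by (auto simp: All_less_Suc2 adj_sym[of G _ x])
  qed auto
qed

lemma ipath_predecessor:
  assumes "ipath G (x # xs)" "q \<in> set xs"
  shows "\<exists>p\<in>set (butlast (x # xs)). adj G p q"
proof -
  obtain ys zs where xs: "xs = ys @ q # zs"
    using split_list[OF assms(2)] by blast
  have "ipath G ((x # ys) @ q # zs)"
    using assms(1) xs by simp
  then have "adj G (last (x # ys)) q"
    unfolding ipath_append by simp
  moreover have "last (x # ys) \<in> set (butlast ((x # ys) @ q # zs))"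
    by (simp add: butlast_append)
  ultimately show ?thesis
    using xs by auto
qed

text \<open>A hole opened at \<open>u\<close>: the other vertices form an induced path whose two
  ends are the only neighbours of \<open>u\<close> on it. This replaces index arithmetic modulo the
  length by statements on paths; three path vertices make the cycle length at least 4.\<close>

definition hole_at :: "'a graph \<Rightarrow> 'a \<Rightarrow> 'a list \<Rightarrow> bool" where
  "hole_at G u ws \<longleftrightarrow> ipath G ws \<and> length ws \<ge> 3 \<and> u \<in> verts G \<and> u \<notin> set ws \<and>
     (\<forall>y\<in>set ws. adj G u y \<longleftrightarrow> y = hd ws \<or> y = last ws)"

lemma hole_at_rev: "hole_at G u ws \<Longrightarrow> hole_at G u (rev ws)"
  by (auto simp: hole_at_def hd_rev last_rev)

text \<open>Reopens a hole at another vertex: going round from \<open>u\<close>, one meets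
  \<open>bs\<close>, then \<open>x\<close>, then \<open>as\<close>.\<close>

lemma hole_at_rotate:
  assumes "hole_at G x (as @ u # bs)"
  shows "hole_at G u (bs @ x # as)"
proof -
  have "set as \<inter> set bs = {}"
    using assms unfolding hole_at_def ipath_append by auto
  then have "as \<noteq> [] \<Longrightarrow> hd as \<notin> set bs" "bs \<noteq> [] \<Longrightarrow> last bs \<notin> set as"
    using hd_in_set last_in_set by blast+
  then have 1: "ipath G as" "ipath G bs" "x \<in> verts G" "u \<in> verts G" "u \<notin> set bs" "x \<noteq> u"
    "u \<notin> set as" "x \<notin> set as" "x \<notin> set bs" "set as \<inter> set bs = {}"
    and l: "length as + length bs \<ge> 2"
    and ub: "\<forall>y\<in>set bs. adj G u y \<longleftrightarrow> y = hd bs"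
    and au: "\<forall>y\<in>set as. adj G y u \<longleftrightarrow> y = last as"
    and ab: "\<forall>y\<in>set as. \<forall>z\<in>set bs. \<not> adj G y z"
    and xu: "adj G x u \<longleftrightarrow> as = [] \<or> bs = []"
    and xa: "\<forall>y\<in>set as. adj G x y \<longleftrightarrow> y = hd as"
    and xb: "\<forall>y\<in>set bs. adj G x y \<longleftrightarrow> y = last bs"
    using assms unfolding hole_at_def ipath_append
    by (auto simp: hd_append last_append split: if_splits)
  have "\<forall>z\<in>set bs. \<forall>y\<in>set as. \<not> adj G z y"
    using ab adj_sym by metis
  then have "ipath G (bs @ x # as)"
    unfolding ipath_append using 1 xa xb by (auto simp: adj_sym[of G _ x])
  moreover have "\<forall>y\<in>set (bs @ x # as). adj G u y \<longleftrightarrow> y = hd (bs @ x # as) \<or> y = last (bs @ x # as)"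
    using 1 ub au xu l by (auto simp: hd_append adj_sym[of G _ u])
  ultimately show ?thesis
    using 1 l unfolding hole_at_def by auto
qed

lemma hole_at_is_hole:
  assumes "hole_at G u ws"
  shows "is_hole G (insert u (set ws))"
proof -
  let ?n = "length ws"
  have ip: "distinct ws" "set ws \<subseteq> verts G"
    "\<And>i j. i < ?n \<Longrightarrow> j < ?n \<Longrightarrow> adj G (ws ! i) (ws ! j) \<longleftrightarrow> j = Suc i \<or> i = Suc j"
    and n: "?n \<ge> 3" and u: "u \<in> verts G" "u \<notin> set ws"
    and ad: "\<forall>y\<in>set ws. adj G u y \<longleftrightarrow> y = hd ws \<or> y = last ws"
    using assms unfolding hole_at_def ipath_nth by auto
  have ne: "ws \<noteq> []" using n by auto
  have un: "adj G u (ws ! j) \<longleftrightarrow> j = 0 \<or> Suc j = ?n" if "j < ?n" for j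
  proof -
    have "adj G u (ws ! j) \<longleftrightarrow> ws ! j = ws ! 0 \<or> ws ! j = ws ! (?n - 1)"
      using ad that ne by (simp add: hd_conv_nth last_conv_nth)
    also have "\<dots> \<longleftrightarrow> j = 0 \<or> j = ?n - 1"
      using nth_eq_iff_index_eq[OF ip(1) that, of 0]
        nth_eq_iff_index_eq[OF ip(1) that, of "?n - 1"] n ne by auto
    finally show ?thesis using that by auto
  qed
  have md: "Suc (Suc j) mod Suc ?n = (if Suc j = ?n then 0 else Suc (Suc j))" if "j < ?n" for j
    using that by auto
  have "\<forall>i<length (u # ws). \<forall>j<length (u # ws). adj G ((u # ws) ! i) ((u # ws) ! j) \<longleftrightarrow>
              (j = Suc i mod length (u # ws) \<or> i = Suc j mod length (u # ws))"
    using ip(3) un n by (auto simp: All_less_Suc2 md adj_sym[of G _ u])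
  moreover have "distinct (u # ws)" "length (u # ws) \<ge> 4"
    using ip u n by auto
  ultimately show ?thesis
    unfolding is_hole_def using ip(2) u by (intro conjI exI[of _ "u # ws"]) auto
qed

text \<open>The cyclic listing in \<open>is_hole\<close> opens the hole at its first vertex
  \<open>x\<close>; rotation then moves the opening to \<open>u\<close>.\<close>

lemma is_hole_obtain:
  assumes "is_hole G H" "u \<in> H"
  obtains ws where "hole_at G u ws" "H = insert u (set ws)"
proof -
  obtain xs where xs: "distinct xs" "set xs = H" "length xs \<ge> 4" "H \<subseteq> verts G"
    "\<And>i j. i < length xs \<Longrightarrow> j < length xs \<Longrightarrow> adj G (xs ! i) (xs ! j) \<longleftrightarrow>
              (j = Suc i mod length xs \<or> i = Suc j mod length xs)"
    using assms(1) unfolding is_hole_def by blast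
  obtain x ws where c: "xs = x # ws"
    using xs(3) by (cases xs) auto
  let ?n = "length ws"
  have n: "?n \<ge> 3" using xs(3) c by simp
  have ne: "ws \<noteq> []" using n by auto
  have md: "Suc (Suc j) mod Suc ?n = (if Suc j = ?n then 0 else Suc (Suc j))" if "j < ?n" for j
    using that by auto
  have "ipath G ws"
    unfolding ipath_nth
  proof (intro conjI allI impI)
    fix i j assume ij: "i < ?n" "j < ?n"
    show "adj G (ws ! i) (ws ! j) \<longleftrightarrow> j = Suc i \<or> i = Suc j"
      using xs(5)[of "Suc i" "Suc j"] ij md[OF ij(1)] md[OF ij(2)] unfolding c
      by (auto split: if_splits)
  qed (use xs(1,2,4) c in auto)
  moreover have "adj G x (ws ! j) \<longleftrightarrow> ws ! j = hd ws \<or> ws ! j = last ws" if "j < ?n" for j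
  proof -
    have "ws ! j = hd ws \<or> ws ! j = last ws \<longleftrightarrow> j = 0 \<or> j = ?n - 1"
      using nth_eq_iff_index_eq[of ws j 0] nth_eq_iff_index_eq[of ws j "?n - 1"]
        xs(1) c that n ne by (auto simp: hd_conv_nth last_conv_nth)
    then show ?thesis
      using xs(5)[of 0 "Suc j"] that n md[OF that] unfolding c by (auto split: if_splits)
  qed
  then have "\<forall>y\<in>set ws. adj G x y \<longleftrightarrow> y = hd ws \<or> y = last ws"
    by (metis in_set_conv_nth)
  ultimately have h: "hole_at G x ws"
    unfolding hole_at_def using xs(1,2,4) c n by auto
  show ?thesis
  proof (cases "u = x")
    case True
    then show ?thesis using that h xs(2) c by auto
  next
    case False
    then obtain as bs where ws: "ws = as @ u # bs"
      using assms(2) xs(2) c by (auto dest: split_list)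
    have "hole_at G u (bs @ x # as)"
      using hole_at_rotate h ws by simp
    moreover have "H = insert u (set (bs @ x # as))"
      using xs(2) c ws by auto
    ultimately show ?thesis by (rule that)
  qed
qed

lemma hole_at_subset_verts: "hole_at G u ws \<Longrightarrow> insert u (set ws) \<subseteq> verts G"
  by (auto simp: hole_at_def dest: ipath_verts)

text \<open>Replacing the part of the hole between the first and the last neighbour of \<open>p\<close> by \<open>p\<close>
  keeps both edges at \<open>m\<close>.\<close>

lemma hole_shortcut:
  assumes h: "hole_at G m ws" and p: "p \<in> verts G" "p \<noteq> m" "p \<notin> set ws" "\<not> adj G p m"
    and cd: "c \<in> set ws" "d \<in> set ws" "adj G p c" "adj G p d" "c \<noteq> d" "\<not> adj G c d"
  shows "\<exists>ws'. hole_at G m ws' \<and> p \<in> set ws' \<and> set ws' \<subseteq> insert p (set ws) \<and>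
    hd ws' = hd ws \<and> last ws' = last ws"
proof -
  obtain as f bs where ws: "ws = as @ f # bs" and f: "adj G p f" and as: "\<forall>y\<in>set as. \<not> adj G p y"
    using split_list_first_prop[of ws "adj G p"] cd by blast
  have ip: "ipath G (as @ f # bs)" using h ws unfolding hole_at_def by simp
  \<comment> \<open>All neighbours of \<open>p\<close> on \<open>ws\<close> lie in
    \<open>f # bs\<close>. If none lay in \<open>tl bs\<close>, then \<open>c\<close> and
    \<open>d\<close> would be \<open>f\<close> and its successor, which are adjacent.\<close>
  have "\<exists>e\<in>set (tl bs). adj G p e"
  proof -
    have "c \<in> set (f # bs)" "d \<in> set (f # bs)" using cd as ws by auto
    moreover have "adj G f (hd bs)" if "bs \<noteq> []"
      using ip that unfolding ipath_append by simp
    ultimately show ?thesis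
      using cd by (cases bs) (auto simp: adj_sym)
  qed
  then obtain h' bs' e where bs: "bs = h' # bs'" "e \<in> set bs'" "adj G p e"
    by (cases bs) auto
  obtain cs l es where bs': "bs' = cs @ l # es" and l: "adj G p l" and es: "\<forall>y\<in>set es. \<not> adj G p y"
    using split_list_last_prop[of bs' "adj G p"] bs by blast
  \<comment> \<open>The removed stretch between \<open>f\<close> and \<open>l\<close> is nonempty,
    so \<open>f\<close> and \<open>l\<close> are nonadjacent and the detour through \<open>p\<close>
    has no chord.\<close>
  let ?ws' = "as @ f # p # l # es"
  have w: "ws = as @ f # h' # cs @ l # es" using ws bs bs' by simp
  have "ipath G ?ws'"
    using h p f l as es unfolding hole_at_def w
    by (auto simp: ipath_append adj_sym[of G _ p])
  moreover have hl: "hd ?ws' = hd ws" "last ?ws' = last ws"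
    unfolding w by (auto simp: hd_append)
  moreover have "\<forall>y\<in>set ?ws'. adj G m y \<longleftrightarrow> y = hd ?ws' \<or> y = last ?ws'"
  proof
    fix y assume y: "y \<in> set ?ws'"
    show "adj G m y \<longleftrightarrow> y = hd ?ws' \<or> y = last ?ws'"
    proof (cases "y = p")
      case True
      have "hd ws \<in> set ws" "last ws \<in> set ws" unfolding w by (auto simp: hd_append)
      then show ?thesis using True p hl by (auto simp: adj_sym)
    next
      case False
      then have "y \<in> set ws" using y w by auto
      then show ?thesis using h hl unfolding hole_at_def by auto
    qed
  qed
  ultimately have "hole_at G m ?ws'"
    using h p unfolding hole_at_def w by auto
  then show ?thesis using hl w by (intro exI[of _ ?ws']) auto
qed


text \<open>Opening the cycle at \<open>hd ps\<close> reduces this to \<open>hole_at\<close>. Three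
  vertices in \<open>ps\<close> keep its ends apart and make the cycle long enough even if
  \<open>qs\<close> is a single vertex.\<close>

lemma is_hole_join:
  assumes p: "ipath G ps" "length ps \<ge> 3" and q: "ipath G qs" "qs \<noteq> []"
    and disj: "set ps \<inter> set qs = {}"
    and cross: "\<And>x y. x \<in> set ps \<Longrightarrow> y \<in> set qs \<Longrightarrow>
      adj G x y \<longleftrightarrow> x = last ps \<and> y = hd qs \<or> x = hd ps \<and> y = last qs"
  shows "is_hole G (set ps \<union> set qs)"
proof -
  obtain x xs where ps: "ps = x # xs" "length xs \<ge> 2"
    using p(2) by (cases ps) auto
  then have xs: "xs \<noteq> []" by auto
  have x: "x \<in> verts G" "x \<notin> set xs" "ipath G xs" "\<forall>y\<in>set xs. adj G x y \<longleftrightarrow> y = hd xs"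
    using p(1) ps by auto
  have xl: "x \<noteq> last xs" "hd xs \<notin> set qs" "last qs \<notin> set xs"
    using x(2) disj ps(1) last_in_set[OF xs] hd_in_set[OF xs] last_in_set[OF q(2)]
    by (metis, metis disjoint_iff list.set_intros(2), metis disjoint_iff list.set_intros(2))
  have "adj G y z \<longleftrightarrow> y = last xs \<and> z = hd qs" if "y \<in> set xs" "z \<in> set qs" for y z
    using cross[of y z] that x(2) ps xs by auto
  then have "ipath G (xs @ qs)"
    unfolding ipath_append using x(3) q(1) disj ps(1) by auto
  moreover have "adj G x y \<longleftrightarrow> y = hd xs \<or> y = last qs" if "y \<in> set xs \<union> set qs" for y
    using that cross[of x y] x(4) xl ps xs by auto
  moreover have "length (xs @ qs) \<ge> 3"
    using ps(2) q(2) by (cases qs) auto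
  ultimately have "hole_at G x (xs @ qs)"
    unfolding hole_at_def using x(1,2) ps(1) xs q(2) disj by auto
  from hole_at_is_hole[OF this] show ?thesis
    using ps(1) by simp
qed

section \<open>The NC property and paths attached to a hole through \<open>u\<close>\<close>

text \<open>The extremal configuration for \<open>nc_sides\<close>: \<open>rs\<close> touches the
  \<open>as\<close> side only from its first vertex and the \<open>bs\<close> side only from its
  last. The hole formed with the arc around \<open>a\<close> then violates the NC property.\<close>

lemma nc_sides_ends:
  assumes nc: "nc_vertex G u" and h: "hole_at G u (as @ a # bs)"
    and rs: "ipath G rs" "rs \<noteq> []" and disj: "set rs \<inter> insert u (set (as @ a # bs)) = {}"
    and na: "\<forall>r\<in>set rs. \<not> adj G r a"
    and c: "c \<in> set as" "adj G (hd rs) c" and d: "d \<in> set bs" "adj G (last rs) d"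
    and tl: "\<forall>r\<in>set (tl rs). \<forall>x\<in>set as. \<not> adj G r x"
    and bl: "\<forall>r\<in>set (butlast rs). \<forall>x\<in>set bs. \<not> adj G r x"
  shows False
proof -
  \<comment> \<open>\<open>c'\<close> and \<open>d'\<close> are the attachments nearest to
    \<open>a\<close> on the two sides, so no other vertex of the arc between them is adjacent to
    \<open>rs\<close>.\<close>
  obtain as1 c' as2 where as: "as = as1 @ c' # as2" and c': "adj G (hd rs) c'"
    and as2: "\<forall>y\<in>set as2. \<not> adj G (hd rs) y"
    using split_list_last_prop[of as "adj G (hd rs)"] c by blast
  obtain bs1 d' bs2 where bs: "bs = bs1 @ d' # bs2" and d': "adj G (last rs) d'"
    and bs1: "\<forall>y\<in>set bs1. \<not> adj G (last rs) y"
    using split_list_first_prop[of bs "adj G (last rs)"] d by blast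
  define ps where "ps = c' # as2 @ a # bs1 @ [d']"
  have ipall: "ipath G (as @ a # bs)" using h by (simp add: hole_at_def)
  have "as @ a # bs = as1 @ ps @ bs2" unfolding as bs ps_def by simp
  then have ip: "ipath G ps" using ipall by (simp add: ipath_append)
  have rsc: "r = hd rs \<or> r \<in> set (tl rs)" "r = last rs \<or> r \<in> set (butlast rs)"
    if "r \<in> set rs" for r
  proof -
    show "r = hd rs \<or> r \<in> set (tl rs)" using that by (cases rs) auto
    have "rs = butlast rs @ [last rs]" using rs(2) by simp
    then have "r \<in> set (butlast rs @ [last rs])" using that by metis
    then show "r = last rs \<or> r \<in> set (butlast rs)" by auto
  qed
  have asr: "adj G r x \<longleftrightarrow> x = c' \<and> r = hd rs" if "x \<in> set (c' # as2)" "r \<in> set rs" for x r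
    using rsc(1)[OF that(2)] that tl as2 c' as ip unfolding ps_def by auto
  have bsr: "adj G r x \<longleftrightarrow> x = d' \<and> r = last rs" if "x \<in> set (bs1 @ [d'])" "r \<in> set rs" for x r
    using rsc(2)[OF that(2)] that bl bs1 d' bs ip unfolding ps_def by (auto simp: ipath_append)
  have cd: "c' \<notin> set (bs1 @ [d'])" "d' \<notin> set (c' # as2)" "c' \<noteq> a" "d' \<noteq> a"
    using ip unfolding ps_def by (auto simp: ipath_append)
  have F: "is_hole G (set ps \<union> set (rev rs))"
  proof (rule is_hole_join[OF ip])
    show "length ps \<ge> 3" by (simp add: ps_def)
    show "set ps \<inter> set (rev rs) = {}" using disj unfolding ps_def as bs by auto
    fix x y assume x: "x \<in> set ps" and y: "y \<in> set (rev rs)"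
    have lh: "last ps = d'" "hd ps = c'" "last (rev rs) = hd rs" "hd (rev rs) = last rs"
      using rs(2) by (auto simp: ps_def last_rev hd_rev)
    consider "x \<in> set (c' # as2)" | "x = a" | "x \<in> set (bs1 @ [d'])"
      using x unfolding ps_def by auto
    then show "adj G x y \<longleftrightarrow> x = last ps \<and> y = hd (rev rs) \<or> x = hd ps \<and> y = last (rev rs)"
    proof cases
      case 1
      then show ?thesis using asr[of x y] y cd lh adj_sym[of G x y] by auto
    next
      case 2
      then show ?thesis using na y cd lh adj_sym[of G x y] by auto
    next
      case 3
      then show ?thesis using bsr[of x y] y cd lh adj_sym[of G x y] by auto
    qed
  qed (use rs in auto)
  \<comment> \<open>The two neighbours of \<open>a\<close> on the arc; both edges at
    \<open>a\<close> lie on the hole through \<open>u\<close> as well as on the new one.\<close>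
  let ?x = "last (c' # as2)" and ?z = "hd (bs1 @ [d'])"
  have xz: "?x \<in> set (c' # as2)" "?z \<in> set (bs1 @ [d'])"
    by (rule last_in_set, simp) (rule hd_in_set, simp)
  have ip': "ipath G ((c' # as2) @ a # (bs1 @ [d']))" using ip by (simp add: ps_def)
  then have "adj G ?x a" "adj G a ?z" "?x \<noteq> ?z"
    using xz unfolding ipath_append by auto
  moreover have "?x \<in> insert u (set (as @ a # bs)) \<inter> (set ps \<union> set (rev rs))"
    "?z \<in> insert u (set (as @ a # bs)) \<inter> (set ps \<union> set (rev rs))"
    "a \<in> insert u (set (as @ a # bs)) \<inter> (set ps \<union> set (rev rs))"
    using xz unfolding as bs ps_def by auto
  moreover have "u \<notin> set ps \<union> set (rev rs)"
    using disj h unfolding hole_at_def ps_def as bs by auto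
  ultimately show False
    using nc F hole_at_is_hole[OF h] unfolding nc_vertex_def by blast
qed

text \<open>A shortest counterexample together with an arc of the hole around \<open>a\<close> is a hole avoiding
  \<open>u\<close> that contains both edges at \<open>a\<close>.\<close>

lemma nc_sides:
  assumes nc: "nc_vertex G u" and h: "hole_at G u (as @ a # bs)"
    and "ipath G rs" "set rs \<inter> insert u (set (as @ a # bs)) = {}"
    and "\<forall>r\<in>set rs. \<not> adj G r a"
    and "r \<in> set rs" "c \<in> set as" "adj G r c" "r' \<in> set rs" "d \<in> set bs" "adj G r' d"
  shows False
  using assms(3-)
proof (induction "length rs" arbitrary: rs r c r' d rule: less_induct)
  case less
  define att where "att R X \<longleftrightarrow> (\<exists>r\<in>set R. \<exists>x\<in>set X. adj G r x)" for R X
  have ne: "rs \<noteq> []" using less.prems by auto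
  have eq: "rs = hd rs # tl rs" "rs = butlast rs @ [last rs]" using ne by auto
  have att: "att rs as" "att rs bs" using less.prems unfolding att_def by blast+
  have ip: "ipath G (tl rs)" "ipath G (butlast rs)"
    using less.prems(1) eq by (metis ipath.simps(2), metis ipath_append)
  have sub: "set (tl rs) \<subseteq> set rs" "set (butlast rs) \<subseteq> set rs"
    using eq by (metis set_subset_Cons, metis Un_upper1 set_append)
  \<comment> \<open>By induction, no shorter end piece of \<open>rs\<close> touches both
    sides.\<close>
  have no: "\<not> (att R as \<and> att R bs)" if "R = tl rs \<or> R = butlast rs" for R
  proof
    assume "att R as \<and> att R bs"
    moreover have "length R < length rs" "ipath G R" "set R \<subseteq> set rs"
      using that ne ip sub by auto
    ultimately show False
      using less.hyps[of R] less.prems(2,3) unfolding att_def by blast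
  qed
  have hdc: "(\<exists>x\<in>set X. adj G (hd rs) x) \<or> att (tl rs) X" if "att rs X" for X
    using that eq(1) unfolding att_def by (metis set_ConsD)
  have lac: "(\<exists>x\<in>set X. adj G (last rs) x) \<or> att (butlast rs) X" if "att rs X" for X
  proof -
    have "set rs = insert (last rs) (set (butlast rs))"
      using eq(2) by (metis Un_insert_right list.simps(15) set_append sup_bot.right_neutral empty_set)
    then show ?thesis using that unfolding att_def by auto
  qed
  show False
  proof (cases "att (tl rs) as \<or> att (butlast rs) bs")
    case False
    then obtain x y where "x \<in> set as" "adj G (hd rs) x" "y \<in> set bs" "adj G (last rs) y"
      using hdc lac att by blast
    then show False
      using nc_sides_ends[OF nc h less.prems(1) ne less.prems(2,3)] False unfolding att_def by blast
  next
    case True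
    \<comment> \<open>Here \<open>rs\<close> runs the other way: by \<open>no\<close>, a tail that
      touches \<open>as\<close> misses \<open>bs\<close>, so \<open>hd rs\<close> touches
      \<open>bs\<close> and \<open>butlast rs\<close>, which contains it, misses \<open>as\<close>.
      The other case is symmetric.\<close>
    have b: "\<not> att (tl rs) bs \<and> \<not> att (butlast rs) as"
    proof (cases "length rs = 1")
      case True
      then have "tl rs = []" "butlast rs = []" by (cases rs; simp)+
      then show ?thesis unfolding att_def by simp
    next
      case False
      then have "hd rs \<in> set (butlast rs)" "last rs \<in> set (tl rs)"
        using ne by (cases rs; auto)+
      then have "\<And>X. \<exists>x\<in>set X. adj G (hd rs) x \<Longrightarrow> att (butlast rs) X"
        "\<And>X. \<exists>x\<in>set X. adj G (last rs) x \<Longrightarrow> att (tl rs) X"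
        unfolding att_def by blast+
      then show ?thesis
        using no[of "tl rs"] no[of "butlast rs"] True hdc[OF att(2)] lac[OF att(1)] by metis
    qed
    then obtain x y where xy: "x \<in> set as" "adj G (last rs) x" "y \<in> set bs" "adj G (hd rs) y"
      using hdc lac att by blast
    have h': "hole_at G u (rev bs @ a # rev as)"
      using hole_at_rev[OF h] by simp
    show False
      by (rule nc_sides_ends[OF nc h' less.prems(1) ne _ less.prems(3), of y x])
        (use less.prems(2) xy b in \<open>auto simp: att_def\<close>)
  qed
qed


text \<open>The new hole leaves \<open>u\<close> along \<open>as\<close> up to the first neighbour
  \<open>f\<close> of \<open>r\<close>, runs back along the path to \<open>r1\<close>, crosses to
  the last neighbour \<open>s\<close> of \<open>r1\<close> in \<open>a # bs\<close> and returns
  along \<open>ds\<close>. If \<open>r\<close> is adjacent to \<open>u\<close>, the first stretch is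
  dropped.\<close>

lemma hole_through_attachment_one_side:
  fixes as bs :: "'a list" and a u :: 'a
  defines "H \<equiv> insert u (set (as @ a # bs))"
  assumes h: "hole_at G u (as @ a # bs)" and ua: "\<not> adj G u a"
    and ip: "ipath G (a # r1 # ss @ [r])"
    and disj: "set (r1 # ss @ [r]) \<inter> H = {}"
    and r1u: "\<not> adj G u r1"
    and nobs: "\<forall>q\<in>set (ss @ [r]). \<forall>x\<in>set bs. \<not> adj G q x"
    and good: "\<And>q z y. q \<in> set (r1 # ss) \<Longrightarrow> z \<in> H \<Longrightarrow> y \<in> H \<Longrightarrow> adj G q z \<Longrightarrow> adj G r1 y \<Longrightarrow>
      z = y \<or> adj G z y"
    and bad: "z \<in> H" "y \<in> H" "adj G r z" "adj G r1 y" "z \<noteq> y" "\<not> adj G z y"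
  shows "\<exists>F. is_hole G F \<and> u \<in> F \<and> r1 \<in> F"
proof -
  have ipH: "ipath G (as @ a # bs)" and uH: "u \<in> verts G" "u \<notin> set (as @ a # bs)"
    and uadj: "\<And>x. x \<in> set (as @ a # bs) \<Longrightarrow>
      adj G u x \<longleftrightarrow> x = hd (as @ a # bs) \<or> x = last (as @ a # bs)"
    using h[unfolded hole_at_def] by blast+
  have asne: "as \<noteq> []" using ua uadj[of a] by auto
  have r1a: "adj G r1 a" using ip by (simp add: adj_sym)
  have na: "\<not> adj G q a" if "q \<in> set (ss @ [r])" for q
    using ip that adj_sym[of G a q] by auto
  obtain cs s ds where sp: "a # bs = cs @ s # ds" and s: "adj G r1 s"
    and ds: "\<forall>y\<in>set ds. \<not> adj G r1 y"
    using split_list_last_prop[of "a # bs" "adj G r1"] r1a by auto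
  have sub: "set (s # ds) \<subseteq> set (a # bs)" unfolding sp by auto
  have lst: "last (s # ds) = last (as @ a # bs)" unfolding sp by simp
  have ips: "ipath G (s # ds)"
    using ipH unfolding sp by (simp only: ipath_append)
  define R where "R = rev (r1 # ss @ [r])"
  have ipR: "ipath G R" using ip unfolding R_def ipath_rev by simp
  have setR: "set R = set (r1 # ss @ [r])" and R: "hd R = r" "last R = r1" "R \<noteq> []"
    unfolding R_def by (auto simp: hd_append)
  have r1n: "r1 \<notin> set (ss @ [r])" "r \<notin> set (r1 # ss)"
    using ip by (auto simp: ipath_append)
  have RS: "adj G q x \<longleftrightarrow> q = r1 \<and> x = s" if "q \<in> set R" "x \<in> set (s # ds)" for q x
  proof (cases "q = r1")
    case True
    then show ?thesis using that ds s by auto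
  next
    case False
    then have "q \<in> set (ss @ [r])" using that setR by auto
    moreover have "x = a \<or> x \<in> set bs" using that sub by auto
    ultimately show ?thesis using na nobs False by auto
  qed
  have dRS: "set R \<inter> set (s # ds) = {}"
    using disj sub setR unfolding H_def by auto
  have ipRS: "ipath G (R @ s # ds)"
    unfolding ipath_append using ipR ips dRS RS R by simp
  have uS: "adj G u x \<longleftrightarrow> x = last (s # ds)" if "x \<in> set (s # ds)" for x
  proof -
    have "x \<in> set (a # bs)" using that sub by auto
    moreover have "hd as \<in> set as" using asne by simp
    ultimately have "x \<noteq> hd as" "x \<in> set (as @ a # bs)"
      using ipH unfolding ipath_append by auto
    then show ?thesis using uadj[of x] lst asne by simp
  qed
  \<comment> \<open>Such an edge would make \<open>u\<close> and \<open>a\<close>, attachments of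
    \<open>q\<close> and \<open>r1\<close>, adjacent.\<close>
  have uq: "\<not> adj G u q" if "q \<in> set (r1 # ss)" for q
    using good[OF that, of u a] r1a ua uH adj_sym[of G u q] unfolding H_def by auto
  show ?thesis
  proof (cases "adj G u r")
    case True
    have uns: "u \<notin> set R" using disj setR unfolding H_def by auto
    have "length (R @ s # ds) \<ge> 3" unfolding R_def by simp
    moreover have "adj G u x \<longleftrightarrow> x = hd (R @ s # ds) \<or> x = last (R @ s # ds)"
      if "x \<in> set (R @ s # ds)" for x
    proof -
      have hl: "hd (R @ s # ds) = r" "last (R @ s # ds) = last (s # ds)" using R by auto
      have lin: "last (s # ds) \<in> set (s # ds)" "last (s # ds) \<notin> set R" "r \<in> set R"
        using dRS last_in_set[of "s # ds"] setR by auto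
      show ?thesis
      proof (cases "x \<in> set R")
        case True
        then have "x = r \<or> x \<in> set (r1 # ss)" using setR by auto
        then have "adj G u x \<longleftrightarrow> x = r" using uq \<open>adj G u r\<close> r1n(2) by blast
        then show ?thesis unfolding hl using lin(2) True by metis
      next
        case False
        then have x: "x \<in> set (s # ds)" using that by auto
        show ?thesis unfolding hl using uS[OF x] lin(3) False by metis
      qed
    qed
    moreover have "u \<notin> set (R @ s # ds)" using uns uH sub by auto
    ultimately have "hole_at G u (R @ s # ds)"
      unfolding hole_at_def using ipRS uH by blast
    from hole_at_is_hole[OF this] show ?thesis using setR by (intro exI) auto
  next
    case False
    then have "z \<noteq> u" using bad adj_sym[of G u r] by auto
    moreover have "z \<noteq> a" "z \<notin> set bs" using bad na nobs by auto
    ultimately have zas: "z \<in> set as" using bad(1) unfolding H_def by auto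
    then obtain es f gs where as: "as = es @ f # gs" and f: "adj G r f"
      and es: "\<forall>x\<in>set es. \<not> adj G r x"
      using split_list_first_prop[of as "adj G r"] bad by blast
    have zf: "z \<in> set (f # gs)" using zas es bad as by auto
    define E where "E = es @ [f]"
    have asE: "as = E @ gs" using as E_def by simp
    have E: "E \<noteq> []" "last E = f" "set E \<subseteq> set as" "hd E = hd as"
      unfolding E_def as by (auto simp: hd_append)
    have ipas: "ipath G as" using ipH by (simp only: ipath_append)
    then have ipE: "ipath G E" unfolding asE by (simp add: ipath_append)
    have asa: "adj G e x \<longleftrightarrow> e = last as \<and> x = a" if "e \<in> set as" "x \<in> set (a # bs)" for e x
      using ipH that unfolding ipath_append by auto
    \<comment> \<open>An edge could only join \<open>last as\<close> to \<open>a\<close>. Then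
      \<open>z = last as\<close> and \<open>s = a\<close>, and as the attachments of
      \<open>r1\<close> itself are pairwise equal or adjacent, \<open>y\<close> would be
      \<open>last as\<close> too.\<close>
    have ES: "\<not> adj G e x" if e: "e \<in> set E" and x: "x \<in> set (s # ds)" for e x
    proof
      assume "adj G e x"
      moreover have "e \<in> set as" "x \<in> set (a # bs)" using e x E sub by auto
      ultimately have ex: "e = last as" "x = a" using asa by auto
      have gs: "gs = []"
      proof (rule ccontr)
        assume g: "gs \<noteq> []"
        then have "last as \<in> set gs" unfolding asE by simp
        then show False using e ex ipas unfolding asE ipath_append by auto
      qed
      have "a \<notin> set bs" using ipH by (simp add: ipath_append)
      have sa: "s = a" "ds = bs"
      proof -
        have "cs = []"
        proof (rule ccontr)
          assume "cs \<noteq> []"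
          then obtain c cs' where "cs = c # cs'" by (cases cs) auto
          then have "bs = cs' @ s # ds" using sp by simp
          then show False using x ex \<open>a \<notin> set bs\<close> by auto
        qed
        then show "s = a" "ds = bs" using sp by auto
      qed
      have zl: "z = last as" "f = last as" using zf gs as by auto
      have "adj G z a" using asa zl(1) zas by auto
      then have "y \<noteq> a" using bad by auto
      moreover have "y \<noteq> u" using bad r1u adj_sym[of G u r1] by auto
      moreover have "y \<notin> set bs" using ds sa bad by auto
      ultimately have yas: "y \<in> set as" using bad(2) unfolding H_def by auto
      have "y = a \<or> adj G y a"
        by (rule good[of r1 y a]) (use bad r1a in \<open>auto simp: H_def\<close>)
      then have "y = last as" using asa[OF yas] \<open>y \<noteq> a\<close> by auto
      then show False using bad zl by auto
    qed
    have sH: "s \<in> H" using sub unfolding H_def by auto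
    \<comment> \<open>An edge from \<open>e\<close> to a path vertex before \<open>r\<close> would
      by \<open>good\<close> make \<open>e\<close> equal or adjacent to \<open>s\<close>; both are
      excluded.\<close>
    have ER: "adj G e q \<longleftrightarrow> e = f \<and> q = r" if e: "e \<in> set E" and q: "q \<in> set R" for e q
    proof (cases "q = r")
      case True
      then show ?thesis using e f es adj_sym[of G e r] unfolding E_def by auto
    next
      case False
      then have q': "q \<in> set (r1 # ss)" using q setR by auto
      have "\<not> adj G e q"
      proof
        assume "adj G e q"
        then have "e = s \<or> adj G e s"
          using good[OF q', of e s] e E sH s adj_sym[of G e q] unfolding H_def by auto
        moreover have "e \<noteq> s"
        proof -
          have "s \<in> set (a # bs)" using sub by auto
          then show ?thesis using e E ipH unfolding ipath_append by auto
        qed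
        ultimately show False using ES[OF e, of s] by auto
      qed
      then show ?thesis using False by auto
    qed
    have dE: "set E \<inter> set (R @ s # ds) = {}"
    proof -
      have "set E \<inter> set R = {}" using disj E setR unfolding H_def by auto
      moreover have "set E \<inter> set (s # ds) = {}"
        using E sub ipH unfolding ipath_append by blast
      ultimately show ?thesis by auto
    qed
    have ipA: "ipath G (E @ R @ s # ds)"
    proof -
      have "adj G e x \<longleftrightarrow> e = last E \<and> x = hd (R @ s # ds)"
        if "e \<in> set E" "x \<in> set (R @ s # ds)" for e x
      proof (cases "x \<in> set R")
        case True
        then show ?thesis using ER that E R by auto
      next
        case F: False
        then have "x \<in> set (s # ds)" using that by auto
        moreover have "r \<in> set R" using setR by auto
        ultimately show ?thesis using ES[OF that(1)] F R by auto
      qed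
      then show ?thesis
        unfolding ipath_append[of G E] using ipE ipRS dE by blast
    qed
    have "length (E @ R @ s # ds) \<ge> 3" unfolding R_def by simp
    moreover have "adj G u x \<longleftrightarrow> x = hd (E @ R @ s # ds) \<or> x = last (E @ R @ s # ds)"
      if x: "x \<in> set (E @ R @ s # ds)" for x
    proof -
      have hl: "hd (E @ R @ s # ds) = hd as" "last (E @ R @ s # ds) = last (s # ds)"
        using E R by auto
      have lin: "last (s # ds) \<in> set (s # ds)" "hd as \<in> set E"
        using E hd_in_set[of E] last_in_set[of "s # ds"] by auto
      have d: "x \<in> set E \<Longrightarrow> x \<notin> set R \<and> x \<notin> set (s # ds)" "x \<in> set R \<Longrightarrow> x \<notin> set (s # ds)"
        using dE dRS by auto
      consider "x \<in> set E" | "x \<in> set R" | "x \<in> set (s # ds)" using x by auto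
      then show ?thesis
      proof cases
        case 1
        then have "adj G u x \<longleftrightarrow> x = hd as \<or> x = last (s # ds)"
          using uadj[of x] E asne lst by auto
        then show ?thesis unfolding hl .
      next
        case 2
        then have "\<not> adj G u x" using uq setR False by auto
        moreover have "x \<noteq> hd as" "x \<noteq> last (s # ds)" using 2 d lin by metis+
        ultimately show ?thesis unfolding hl by blast
      next
        case 3
        moreover have "x \<noteq> hd as" using 3 d lin by metis
        ultimately show ?thesis unfolding hl using uS by blast
      qed
    qed
    moreover have "u \<notin> set (E @ R @ s # ds)"
      using uH sub E disj setR unfolding H_def by auto
    ultimately have "hole_at G u (E @ R @ s # ds)"
      unfolding hole_at_def using ipA uH by blast
    from hole_at_is_hole[OF this] show ?thesis using setR by (intro exI) auto
  qed
qed


definition on_hole :: "'a graph \<Rightarrow> 'a \<Rightarrow> 'a \<Rightarrow> bool" where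
  "on_hole G u w \<longleftrightarrow> (\<exists>F. is_hole G F \<and> u \<in> F \<and> w \<in> F)"

text \<open>For the first violation \<open>r\<close> along the path, the part of the path up to \<open>r\<close> attaches to only
  one side of \<open>a\<close> on the hole, and rerouting the hole through it gives a hole containing \<open>u\<close>
  and \<open>r1\<close>.\<close>

lemma attachments_close:
  assumes nc: "nc_vertex G u" and h: "hole_at G u vs" and a: "a \<in> set vs" "\<not> adj G u a"
    and ip: "ipath G (a # r1 # rs)" and r1: "\<not> adj G u r1" "\<not> on_hole G u r1"
    and q: "q \<in> set (r1 # rs)" and zy: "z \<in> insert u (set vs)" "y \<in> insert u (set vs)"
      "adj G q z" "adj G r1 y"
  shows "z = y \<or> adj G z y"
proof (rule ccontr)
  assume neg: "\<not> (z = y \<or> adj G z y)"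
  let ?H = "insert u (set vs)"
  define bad where "bad q \<longleftrightarrow> (\<exists>z\<in>?H. \<exists>y\<in>?H. adj G q z \<and> adj G r1 y \<and> z \<noteq> y \<and> \<not> adj G z y)" for q
  have "bad q" using zy neg unfolding bad_def by blast
  then obtain ss r ts where sp: "r1 # rs = ss @ r # ts" and r: "bad r" and ss: "\<forall>q\<in>set ss. \<not> bad q"
    using split_list_first_prop[of "r1 # rs" bad] q by blast
  have hole: "is_hole G ?H" by (rule hole_at_is_hole[OF h])
  have r1H: "r1 \<notin> ?H" using r1(2) hole unfolding on_hole_def by blast
  have uv: "u \<notin> set vs" using h unfolding hole_at_def by blast
  have r1a: "adj G r1 a" using ip by (simp add: adj_sym)
  have anu: "a \<noteq> u" using a uv by auto
  show False
  proof (cases ss)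
    case Nil
    \<comment> \<open>Here \<open>r1\<close> itself has two nonadjacent neighbours on the hole;
      shortcutting through it, with the hole opened at \<open>u\<close>, puts \<open>r1\<close> on a
      hole with \<open>u\<close>.\<close>
    then have "r = r1" using sp by simp
    then obtain c d where cd: "c \<in> ?H" "d \<in> ?H" "adj G r1 c" "adj G r1 d" "c \<noteq> d" "\<not> adj G c d"
      using r unfolding bad_def by blast
    have r1u: "\<not> adj G r1 u" using r1(1) adj_sym by metis
    have "c \<in> set vs" using cd(1,3) r1u by auto
    moreover have "d \<in> set vs" using cd(2,4) r1u by auto
    moreover have "r1 \<in> verts G" "r1 \<noteq> u" "r1 \<notin> set vs" using ip r1H by auto
    ultimately have "\<exists>ws'. hole_at G u ws' \<and> r1 \<in> set ws'"
      using hole_shortcut[OF h _ _ _ r1u _ _ cd(3-6)] by metis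
    then obtain ws' where w: "hole_at G u ws'" "r1 \<in> set ws'" by blast
    then have "on_hole G u r1"
      unfolding on_hole_def using hole_at_is_hole[OF w(1)] by blast
    then show False using r1(2) by blast
  next
    case (Cons r0 ss')
    then have ss': "ss = r1 # ss'" and rs: "rs = ss' @ r # ts" using sp by auto
    have "ipath G ((a # r1 # ss' @ [r]) @ ts)" using ip rs by simp
    then have ip': "ipath G (a # r1 # ss' @ [r])" unfolding ipath_append by blast
    have nadja: "\<not> adj G p a" "p \<noteq> a" if "p \<in> set (ss' @ [r])" for p
      using ip' that adj_sym[of G a p] by auto
    \<comment> \<open>If a path vertex lay on the hole, its predecessor would be bad already, since
      the entry point is neither equal nor adjacent to \<open>a\<close>, an attachment of
      \<open>r1\<close>.\<close>
    have disj: "set (r1 # ss' @ [r]) \<inter> ?H = {}"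
    proof (rule ccontr)
      assume "set (r1 # ss' @ [r]) \<inter> ?H \<noteq> {}"
      then obtain p where p: "p \<in> set (r1 # ss' @ [r])" "p \<in> ?H" by blast
      then have p': "p \<in> set (ss' @ [r])" using r1H by auto
      have "ipath G (r1 # ss' @ [r])" using ip' by simp
      from ipath_predecessor[OF this p'] obtain p0 where p0: "p0 \<in> set ss" "adj G p0 p"
        unfolding ss' by (auto simp: butlast_append)
      then have "bad p0"
        unfolding bad_def using p nadja[OF p'] r1a a by blast
      then show False using ss p0 by blast
    qed
    obtain as bs where vs: "vs = as @ a # bs" using a split_list by fast
    have good: "z = y \<or> adj G z y"
      if "q \<in> set (r1 # ss')" "z \<in> ?H" "y \<in> ?H" "adj G q z" "adj G r1 y" for q z y
      using ss that unfolding ss' bad_def by blast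
    obtain c d where cd: "c \<in> ?H" "d \<in> ?H" "adj G r c" "adj G r1 d" "c \<noteq> d" "\<not> adj G c d"
      using r unfolding bad_def by blast
    have ipX: "ipath G (ss' @ [r])" using ip' by simp
    have dX: "set (ss' @ [r]) \<inter> insert u (set (as @ a # bs)) = {}"
      using disj unfolding vs by auto
    have nX: "\<forall>q\<in>set (ss' @ [r]). \<not> adj G q a" using nadja by blast
    \<comment> \<open>By \<open>nc_sides\<close>, one side of \<open>a\<close> receives no edge from
      \<open>ss' @ [r]\<close>.\<close>
    consider "\<forall>q\<in>set (ss' @ [r]). \<forall>x\<in>set bs. \<not> adj G q x" |
      "\<forall>q\<in>set (ss' @ [r]). \<forall>x\<in>set as. \<not> adj G q x"
      using nc_sides[OF nc h[unfolded vs] ipX dX nX] by blast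
    then have "\<exists>F. is_hole G F \<and> u \<in> F \<and> r1 \<in> F"
    proof cases
      case 1
      show ?thesis
        by (rule hole_through_attachment_one_side[OF h[unfolded vs] a(2) ip'
              disj[unfolded vs] r1(1) 1 good[unfolded vs] cd[unfolded vs]])
    next
      case 2
      have h': "hole_at G u (rev bs @ a # rev as)" using hole_at_rev[OF h] vs by simp
      have H': "insert u (set (rev bs @ a # rev as)) = ?H" unfolding vs by auto
      have 2: "\<forall>q\<in>set (ss' @ [r]). \<forall>x\<in>set (rev as). \<not> adj G q x" using 2 by simp
      show ?thesis
        by (rule hole_through_attachment_one_side[OF h' a(2) ip' _ r1(1) 2, unfolded H',
              OF disj good cd])
    qed
    then show False using r1(2) unfolding on_hole_def by blast
  qed
qed

text \<open>On a hole through \<open>u\<close> and \<open>a\<close>, \<open>a\<close> is an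
  attachment of the first path vertex and \<open>u\<close> one of the last, so
  \<open>attachments_close\<close> would make them adjacent.\<close>

lemma nc_no_escape:
  assumes nc: "nc_vertex G u" and a: "on_hole G u a" "\<not> adj G u a" "a \<noteq> u"
    and ip: "ipath G (a # ps)" "ps \<noteq> []" and p: "\<not> adj G u (hd ps)" "\<not> on_hole G u (hd ps)"
    and l: "adj G u (last ps)"
  shows False
proof -
  obtain p rs where ps: "ps = p # rs" using ip(2) by (cases ps) auto
  obtain F where F: "is_hole G F" "u \<in> F" "a \<in> F" using a(1) unfolding on_hole_def by blast
  obtain vs where vs: "hole_at G u vs" "F = insert u (set vs)" by (rule is_hole_obtain[OF F(1,2)])
  have "a \<in> set vs" using F(3) vs(2) a(3) by blast
  moreover have "adj G p a" using ip(1) ps by (simp add: adj_sym)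
  moreover have "last ps \<in> set (p # rs)" unfolding ps by simp
  moreover have "adj G (last ps) u" using l adj_sym by metis
  ultimately have "u = a \<or> adj G u a"
    using attachments_close[OF nc vs(1), of a p rs "last ps" u a] a(2) ip(1) p unfolding ps by auto
  then show False using a by blast
qed

text \<open>These are the paths that a hole created by \<open>loc_chord\<close> would contain. If
  \<open>b\<close> is not adjacent to \<open>u\<close>, a hole through \<open>u\<close> and
  \<open>b\<close> has an arc from \<open>b\<close> that neither \<open>a\<close> nor
  \<open>ps\<close> touches; following it to a neighbour of \<open>u\<close> gives a path excluded
  by \<open>nc_no_escape\<close>.\<close>

lemma nc_no_bypass:
  assumes nc: "nc_vertex G u" and ip: "ipath G (a # ps @ [b])" "ps \<noteq> []"
    and ps: "\<And>p. p \<in> set ps \<Longrightarrow> \<not> adj G u p \<and> \<not> on_hole G u p"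
    and a: "on_hole G u a" "\<not> adj G u a" "a \<noteq> u"
    and b: "adj G u b \<or> on_hole G u b" "b \<noteq> u"
  shows False
proof -
  have hdps: "hd ps \<in> set ps" "hd (ps @ zs) = hd ps" for zs using ip(2) by auto
  show False
  proof (cases "adj G u b")
    case True
    show False
      by (rule nc_no_escape[OF nc a ip(1)]) (use hdps ps True in auto)
  next
    case ub: False
    then obtain F where F: "is_hole G F" "u \<in> F" "b \<in> F" using b(1) unfolding on_hole_def by blast
    obtain vs where vs: "hole_at G u vs" "F = insert u (set vs)" by (rule is_hole_obtain[OF F(1,2)])
    have bvs: "b \<in> set vs" using F(3) vs(2) b(2) by blast
    obtain r1 rs where r: "rev ps = r1 # rs" using ip(2) by (cases "rev ps") auto
    have r1: "r1 \<in> set ps" using r by (metis list.set_intros(1) set_rev)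
    have setr: "set (r1 # rs @ [a]) = insert a (set ps)" using r by (metis Un_insert_right append_Cons
      empty_set list.simps(15) set_append set_rev sup_bot.right_neutral)
    have "ipath G (rev (a # ps @ [b]))" using ip(1) unfolding ipath_rev .
    then have ipr: "ipath G (b # r1 # rs @ [a])" using r by simp
    have close: "z = y \<or> adj G z y" if "q \<in> insert a (set ps)" "z \<in> F" "y \<in> F" "adj G q z" "adj G r1 y"
      for q z y
      using attachments_close[OF nc vs(1) bvs ub ipr, of q z y] ps[OF r1] that setr vs(2) by auto
    have r1b: "adj G r1 b" using ipr by (simp add: adj_sym)
    have psF: "p \<notin> F" if "p \<in> set ps" for p
      using ps[OF that] F unfolding on_hole_def by blast
    have "b \<notin> set ps" using ip(1) by (auto simp: ipath_append)
    then have "b \<noteq> hd ps" using hdps by metis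
    then have ab: "\<not> adj G a b" "a \<noteq> b" using ip by auto
    \<comment> \<open>Otherwise \<open>a\<close> and \<open>b\<close> would be attachments of path
      vertices on \<open>F\<close>, hence equal or adjacent, although \<open>ps\<close> separates
      them on an induced path.\<close>
    have aF: "a \<notin> F"
    proof
      assume "a \<in> F"
      moreover have "adj G a (hd ps)" using ip by simp
      then have "adj G (hd ps) a" using adj_sym by metis
      ultimately have "a = b \<or> adj G a b" using close[of "hd ps" a b] hdps F r1b by auto
      then show False using ab by blast
    qed
    have extend: False
      if h: "hole_at G u (as @ b # bs)" "F = insert u (set (as @ b # bs))"
        and no: "\<And>q x. q \<in> insert a (set ps) \<Longrightarrow> x \<in> set bs \<Longrightarrow> \<not> adj G q x" for as bs
    proof -
      have u: "adj G u x \<longleftrightarrow> x = hd (as @ b # bs) \<or> x = last (as @ b # bs)"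
        if "x \<in> set (as @ b # bs)" for x
        using h(1) that unfolding hole_at_def by blast
      have bsne: "bs \<noteq> []" using u[of b] ub by auto
      have ipb: "ipath G (b # bs)" using h(1) unfolding hole_at_def ipath_append by blast
      have bbs: "adj G b x \<longleftrightarrow> x = hd bs" if "x \<in> set bs" for x using ipb that by simp
      have "ipath G ((a # ps @ [b]) @ bs)"
        unfolding ipath_append[of G "a # ps @ [b]"]
      proof (intro conjI ballI)
        have "b \<notin> set bs" using ipb by simp
        then show "set (a # ps @ [b]) \<inter> set bs = {}" using psF aF h(2) by auto
        fix q x assume q: "q \<in> set (a # ps @ [b])" and x: "x \<in> set bs"
        show "adj G q x \<longleftrightarrow> q = last (a # ps @ [b]) \<and> x = hd bs"
        proof (cases "q = b")
          case True
          then show ?thesis using bbs x by simp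
        next
          case False
          then show ?thesis using no[of q x] q x by auto
        qed
      qed (use ip(1) ipb in auto)
      then have "ipath G (a # ps @ b # bs)" by simp
      moreover have "last (as @ b # bs) \<in> set (as @ b # bs)" by (rule last_in_set) simp
      then have "adj G u (last (ps @ b # bs))" using u[of "last bs"] bsne by simp
      ultimately show False
        using nc_no_escape[OF nc a, of "ps @ b # bs"] hdps ps by auto
    qed
    obtain as bs where sp: "vs = as @ b # bs" using bvs split_list by fast
    have "(\<forall>q\<in>insert a (set ps). \<forall>x\<in>set bs. \<not> adj G q x) \<or>
      (\<forall>q\<in>insert a (set ps). \<forall>x\<in>set as. \<not> adj G q x)"
    proof (rule ccontr)
      assume "\<not> ?thesis"
      then obtain q c q' d where qs: "q \<in> insert a (set ps)" "c \<in> set as" "adj G q c"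
        "q' \<in> insert a (set ps)" "d \<in> set bs" "adj G q' d" by blast
      have ipv: "ipath G (as @ b # bs)" using vs(1) unfolding sp hole_at_def by blast
      have cross: "x \<noteq> y \<and> \<not> adj G x y" if "x \<in> set as" "y \<in> set bs" for x y
        using ipv that unfolding ipath_append by auto
      have inF: "set as \<subseteq> F" "set bs \<subseteq> F" using vs(2) sp by auto
      \<comment> \<open>Both sides are touched. A neighbour of \<open>r1\<close> on one side would
        have to be equal or adjacent to an attachment on the other side, across \<open>b\<close>; so
        \<open>r1\<close> touches neither, and the contact vertices lie beyond it on the
        path.\<close>
      have "\<not> adj G r1 x" if "x \<in> set as" for x
        using close[OF qs(4), of d x] cross[OF that qs(5)] qs inF that adj_sym[of G x d] by auto
      moreover have "\<not> adj G r1 x" if "x \<in> set bs" for x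
        using close[OF qs(1), of c x] cross[OF qs(2) that] qs inF that by auto
      ultimately have ne: "q \<noteq> r1" "q' \<noteq> r1" using qs by auto
      have ipX: "ipath G (rs @ [a])" using ipr by simp
      have "q \<in> set (r1 # rs @ [a])" "q' \<in> set (r1 # rs @ [a])" using qs(1,4) unfolding setr .
      then have qX: "q \<in> set (rs @ [a])" "q' \<in> set (rs @ [a])" using ne by auto
      have "set (rs @ [a]) \<subseteq> insert a (set ps)" unfolding setr[symmetric] by auto
      then have dX: "set (rs @ [a]) \<inter> insert u (set (as @ b # bs)) = {}"
        using psF aF unfolding vs(2) sp by blast
      have nX: "\<forall>p\<in>set (rs @ [a]). \<not> adj G p b" using ipr adj_sym[of G _ b] by auto
      show False
        by (rule nc_sides[OF nc vs(1)[unfolded sp] ipX dX nX qX(1) qs(2,3) qX(2) qs(5,6)])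
    qed
    then show False
    proof
      assume "\<forall>q\<in>insert a (set ps). \<forall>x\<in>set bs. \<not> adj G q x"
      then show False using extend[of as bs] vs sp by blast
    next
      assume n: "\<forall>q\<in>insert a (set ps). \<forall>x\<in>set as. \<not> adj G q x"
      have "hole_at G u (rev bs @ b # rev as)" using hole_at_rev[OF vs(1)] sp by simp
      moreover have "F = insert u (set (rev bs @ b # rev as))" using vs(2) sp by auto
      ultimately show False using extend[of "rev bs" "rev as"] n by auto
    qed
  qed
qed

section \<open>Local chordalization\<close>

lemma verts_loc_chord [simp]: "verts (loc_chord G u) = verts G"
  by (simp add: loc_chord_def verts_def)

lemma adj_loc_chord:
  "adj (loc_chord G u) x y \<longleftrightarrow>
     adj G x y \<or> x \<noteq> y \<and> (x = u \<and> on_hole G u y \<or> y = u \<and> on_hole G u x)"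
  unfolding adj_def loc_chord_def edges_def on_hole_def by (auto simp: doubleton_eq_iff)

lemma ipath_cong:
  assumes "verts G = verts G'" "\<And>x y. x \<in> set xs \<Longrightarrow> y \<in> set xs \<Longrightarrow> adj G x y = adj G' x y"
  shows "ipath G xs \<longleftrightarrow> ipath G' xs"
  using assms(2) by (induction xs) (auto simp: assms(1))

lemma is_hole_cong:
  assumes v: "F \<subseteq> verts G \<longleftrightarrow> F \<subseteq> verts G'"
    and e: "\<And>x y. x \<in> F \<Longrightarrow> y \<in> F \<Longrightarrow> adj G x y = adj G' x y"
  shows "is_hole G F \<longleftrightarrow> is_hole G' F"
proof -
  have "(\<forall>i<length xs. \<forall>j<length xs. adj G (xs ! i) (xs ! j) \<longleftrightarrow>
            (j = Suc i mod length xs \<or> i = Suc j mod length xs)) \<longleftrightarrow>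
        (\<forall>i<length xs. \<forall>j<length xs. adj G' (xs ! i) (xs ! j) \<longleftrightarrow>
            (j = Suc i mod length xs \<or> i = Suc j mod length xs))" if "set xs = F" for xs
    using e that nth_mem by metis
  then show ?thesis unfolding is_hole_def using v by blast
qed

text \<open>New edges all contain \<open>u\<close>, so the rest of the hole is an induced path of
  \<open>G\<close>. \<open>nc_no_bypass\<close> from either end makes both ends old neighbours of
  \<open>u\<close>; then the cycle was a hole of \<open>G\<close> already and its inner vertices
  would have been joined to \<open>u\<close>.\<close>

lemma loc_chord_no_hole:
  assumes nc: "nc_vertex G u" and F: "is_hole (loc_chord G u) F"
  shows "u \<notin> F"
proof
  assume "u \<in> F"
  let ?G = "loc_chord G u"
  obtain ws where ws: "hole_at ?G u ws" by (rule is_hole_obtain[OF F \<open>u \<in> F\<close>])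
  then have l: "length ws \<ge> 3" and u: "u \<in> verts G" "u \<notin> set ws" and ip: "ipath ?G ws"
    and uadj: "\<And>y. y \<in> set ws \<Longrightarrow> adj ?G u y \<longleftrightarrow> y = hd ws \<or> y = last ws"
    unfolding hole_at_def verts_loc_chord by blast+
  have ipG: "ipath G ws"
    using ip ipath_cong[of ?G G ws] u by (auto simp: adj_loc_chord)
  obtain a xs where ws1: "ws = a # xs" using l by (cases ws) auto
  moreover obtain ps b where "xs = ps @ [b]" using l ws1 by (cases xs rule: rev_cases) auto
  ultimately have w: "ws = a # ps @ [b]" by simp
  have pne: "ps \<noteq> []" using l w by auto
  have ad: "adj ?G u y \<longleftrightarrow> adj G u y \<or> on_hole G u y" if "y \<noteq> u" for y
    using that by (auto simp: adj_loc_chord)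
  have p: "\<not> adj G u p \<and> \<not> on_hole G u p" if "p \<in> set ps" for p
  proof -
    have "p \<noteq> a" "p \<noteq> b" "p \<noteq> u" using ipG that u unfolding w by (auto simp: ipath_append)
    then show ?thesis using uadj[of p] that ad[of p] unfolding w by auto
  qed
  have ab: "a \<noteq> u" "b \<noteq> u" using u w by auto
  have abadj: "adj G u a \<or> on_hole G u a" "adj G u b \<or> on_hole G u b"
    using uadj[of a] uadj[of b] ad ab unfolding w by auto
  have "adj G u a"
    using nc_no_bypass[OF nc ipG[unfolded w] pne p _ _ ab(1) abadj(2) ab(2)] abadj(1) by blast
  moreover have "adj G u b"
  proof -
    have "ipath G (rev (a # ps @ [b]))" using ipG unfolding w ipath_rev .
    then have "ipath G (b # rev ps @ [a])" by simp
    then show ?thesis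
      using nc_no_bypass[of G u b "rev ps" a] nc pne p ab abadj by auto
  qed
  moreover have "a \<noteq> b" using ipG unfolding w by simp
  ultimately have "\<forall>y\<in>set ws. adj G u y \<longleftrightarrow> y = hd ws \<or> y = last ws"
    using p ipG unfolding w by (auto simp: ipath_append)
  then have "hole_at G u ws"
    unfolding hole_at_def using l u ipG by blast
  from hole_at_is_hole[OF this] have "on_hole G u (hd ps)"
    unfolding on_hole_def w using pne by (intro exI) auto
  then show False using p[of "hd ps"] pne by auto
qed

lemma is_hole_loc_chord:
  assumes "nc_vertex G u"
  shows "is_hole (loc_chord G u) F \<longleftrightarrow> is_hole G F \<and> u \<notin> F"
proof -
  have "is_hole (loc_chord G u) F \<longleftrightarrow> is_hole G F" if "u \<notin> F"
    using that by (intro is_hole_cong) (auto simp: adj_loc_chord)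
  then show ?thesis using loc_chord_no_hole[OF assms] by blast
qed


section \<open>Chordalizing by a whole set\<close>

lemma on_hole_sym: "on_hole G x y \<longleftrightarrow> on_hole G y x"
  unfolding on_hole_def by blast

lemma on_hole_verts: "on_hole G x y \<Longrightarrow> x \<in> verts G \<and> y \<in> verts G"
  unfolding on_hole_def is_hole_def by blast

lemma nc_set_unique:
  assumes "nc_set G C" "on_hole G x y" "x \<in> C" "y \<in> C"
  shows "x = y"
proof -
  obtain F where F: "is_hole G F" "x \<in> F" "y \<in> F" using assms(2) unfolding on_hole_def by blast
  then have "finite F" unfolding is_hole_def by (metis List.finite_set)
  moreover have "card (F \<inter> C) \<le> 1" using assms(1) F unfolding nc_set_def by blast
  ultimately show ?thesis using F assms(3,4) card_le_Suc0_iff_eq[of "F \<inter> C"] by auto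
qed

text \<open>By \<open>is_hole_loc_chord\<close> the remaining holes are old ones that avoid
  \<open>u\<close>, and the edges between their vertices are old as well.\<close>

lemma nc_set_loc_chord:
  assumes C: "nc_set G C" and u: "u \<in> C"
  shows "nc_set (loc_chord G u) (C - {u})"
proof -
  have nu: "nc_vertex G u" using C u unfolding nc_set_def by blast
  have "nc_vertex (loc_chord G u) v" if v: "v \<in> C - {u}" for v
    unfolding nc_vertex_def is_hole_loc_chord[OF nu]
  proof clarify
    fix H H' x y z
    assume *: "is_hole G H" "v \<in> H" "u \<notin> H" "is_hole G H'" "v \<notin> H'" "u \<notin> H'" "x \<noteq> z"
      "x \<in> H" "x \<in> H'" "y \<in> H" "y \<in> H'" "z \<in> H" "z \<in> H'"
      "adj (loc_chord G u) x y" "adj (loc_chord G u) y z"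
    then have "x \<noteq> u" "y \<noteq> u" "z \<noteq> u" by auto
    then have "adj G x y" "adj G y z" using *(14,15) by (auto simp: adj_loc_chord)
    moreover have "nc_vertex G v" using v C unfolding nc_set_def by blast
    ultimately show False using * unfolding nc_vertex_def by blast
  qed
  moreover have "card (H \<inter> (C - {u})) \<le> 1" if "is_hole G H" for H
  proof -
    have "finite H" using that unfolding is_hole_def by (metis List.finite_set)
    then have "card (H \<inter> (C - {u})) \<le> card (H \<inter> C)" by (intro card_mono) auto
    also have "\<dots> \<le> 1" using C that unfolding nc_set_def by blast
    finally show ?thesis .
  qed
  ultimately show ?thesis
    unfolding nc_set_def is_hole_loc_chord[OF nu] by blast
qed

lemma graph_loc_chord:
  assumes "graph G" shows "graph (loc_chord G u)"
proof -
  have "edges (loc_chord G u) = edges G \<union> {{u, w} |w. w \<noteq> u \<and> on_hole G u w}"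
    unfolding loc_chord_def edges_def on_hole_def by simp
  moreover have "\<exists>x y. x \<noteq> y \<and> x \<in> verts G \<and> y \<in> verts G \<and> {u, w} = {x, y}"
    if "w \<noteq> u" "on_hole G u w" for w
    using on_hole_verts[OF that(2)] that(1) by blast
  ultimately show ?thesis
    using assms unfolding graph_def by auto
qed

text \<open>The description of the new edges does not mention the order of \<open>us\<close>, so the
  enumeration chosen in \<open>hat\<close> is immaterial.\<close>

lemma chord_seq_props:
  assumes "nc_set G C" "distinct us" "set us \<subseteq> C" "graph G"
  shows "graph (chord_seq G us) \<and> verts (chord_seq G us) = verts G \<and> edges G \<subseteq> edges (chord_seq G us) \<and>
    (\<forall>x y. adj (chord_seq G us) x y \<longleftrightarrow> adj G x y \<or>
       x \<noteq> y \<and> (x \<in> set us \<or> y \<in> set us) \<and> on_hole G x y)"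
  using assms
proof (induction us arbitrary: G C)
  case Nil
  then show ?case by simp
next
  case (Cons u us)
  let ?G = "loc_chord G u"
  have u: "u \<in> C" "u \<notin> set us" using Cons.prems by auto
  have nu: "nc_vertex G u" using Cons.prems u unfolding nc_set_def by blast
  have IH: "graph (chord_seq ?G us)" "verts (chord_seq ?G us) = verts G"
    "edges ?G \<subseteq> edges (chord_seq ?G us)"
    "\<And>x y. adj (chord_seq ?G us) x y \<longleftrightarrow> adj ?G x y \<or>
       x \<noteq> y \<and> (x \<in> set us \<or> y \<in> set us) \<and> on_hole ?G x y"
  proof -
    have "distinct us" "set us \<subseteq> C - {u}" using Cons.prems u by auto
    note Cons.IH[OF nc_set_loc_chord[OF Cons.prems(1) u(1)] this graph_loc_chord[OF Cons.prems(4)]]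
    then show "graph (chord_seq ?G us)" "verts (chord_seq ?G us) = verts G"
      "edges ?G \<subseteq> edges (chord_seq ?G us)"
      "\<And>x y. adj (chord_seq ?G us) x y \<longleftrightarrow> adj ?G x y \<or>
       x \<noteq> y \<and> (x \<in> set us \<or> y \<in> set us) \<and> on_hole ?G x y"
      unfolding verts_loc_chord by blast+
  qed
  \<comment> \<open>A hole through another vertex of \<open>C\<close> avoids \<open>u\<close>, since
    it contains at most one vertex of \<open>C\<close>; hence it survives this step.\<close>
  have oh: "on_hole ?G v w \<longleftrightarrow> on_hole G v w" if "v \<in> set us" for v w
  proof -
    have "v \<in> C" "v \<noteq> u" using that Cons.prems u by auto
    then have "u \<notin> F" if "is_hole G F" "v \<in> F" for F
      using nc_set_unique[OF Cons.prems(1), of u v] that u unfolding on_hole_def by blast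
    then show ?thesis unfolding on_hole_def is_hole_loc_chord[OF nu] by blast
  qed
  have "edges G \<subseteq> edges ?G" unfolding loc_chord_def edges_def by auto
  moreover have "adj (chord_seq ?G us) x y \<longleftrightarrow> adj G x y \<or>
       x \<noteq> y \<and> (x \<in> set (u # us) \<or> y \<in> set (u # us)) \<and> on_hole G x y" for x y
    unfolding IH(4) adj_loc_chord
    using oh[of x y] oh[of y x] on_hole_sym[of G x y] on_hole_sym[of ?G x y] by auto
  ultimately show ?case using IH(1-3) by auto
qed

lemma hat_props:
  assumes "nc_set G C" "finite C" "graph G"
  shows "graph (hat G C)" "verts (hat G C) = verts G" "edges G \<subseteq> edges (hat G C)"
    "adj (hat G C) x y \<longleftrightarrow> adj G x y \<or> x \<noteq> y \<and> (x \<in> C \<or> y \<in> C) \<and> on_hole G x y"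
proof -
  define us where "us = (SOME xs. distinct xs \<and> set xs = C)"
  have "\<exists>xs. distinct xs \<and> set xs = C" using finite_distinct_list[OF assms(2)] by blast
  then have us: "distinct us \<and> set us = C" unfolding us_def by (rule someI_ex)
  have "hat G C = chord_seq G us" unfolding hat_def us_def ..
  then show "graph (hat G C)" "verts (hat G C) = verts G" "edges G \<subseteq> edges (hat G C)"
    "adj (hat G C) x y \<longleftrightarrow> adj G x y \<or> x \<noteq> y \<and> (x \<in> C \<or> y \<in> C) \<and> on_hole G x y"
    using chord_seq_props[of G C us] assms us by auto
qed

section \<open>Connected vertex sets\<close>

lemma connected_set_Un:
  assumes S: "connected_set G S" and T: "connected_set G T" and z: "z \<in> S" "z \<in> T"
  shows "connected_set G (S \<union> T)"
proof -
  define R where "R S = {(a, b). a \<in> S \<and> b \<in> S \<and> adj G a b}" for S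
  have m: "(R S)\<^sup>* \<subseteq> (R (S \<union> T))\<^sup>*" "(R T)\<^sup>* \<subseteq> (R (S \<union> T))\<^sup>*"
    by (rule rtrancl_mono, force simp: R_def)+
  have "(x, z) \<in> (R (S \<union> T))\<^sup>* \<and> (z, x) \<in> (R (S \<union> T))\<^sup>*" if "x \<in> S \<union> T" for x
    using that S T z m unfolding connected_set_def R_def[symmetric] by blast
  then show ?thesis
    unfolding connected_set_def R_def[symmetric] by (blast intro: rtrancl_trans)
qed

lemma connected_set_singleton: "connected_set G {x}"
  unfolding connected_set_def by simp

lemma connected_set_insert:
  assumes "connected_set G S" "s \<in> S" "adj G x s"
  shows "connected_set G (insert x S)"
proof -
  have "connected_set G {x, s}"
    unfolding connected_set_def using assms(3) adj_sym[of G x s] by auto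
  from connected_set_Un[OF this assms(1), of s] show ?thesis
    using assms(2) by (simp add: insert_absorb)
qed

lemma connected_set_ipath: "ipath G xs \<Longrightarrow> connected_set G (set xs)"
proof (induction xs)
  case Nil
  then show ?case by (simp add: connected_set_def)
next
  case (Cons x xs)
  show ?case
  proof (cases "xs = []")
    case True
    then show ?thesis by (simp add: connected_set_singleton)
  next
    case False
    then have "hd xs \<in> set xs" "adj G x (hd xs)" using Cons.prems by auto
    then show ?thesis using connected_set_insert Cons by fastforce
  qed
qed

lemma ipath_between:
  assumes "(s, t) \<in> {(a, b). a \<in> Y \<and> b \<in> Y \<and> adj G a b}\<^sup>*" "s \<in> Y" "Y \<subseteq> verts G"
  shows "\<exists>xs. ipath G xs \<and> xs \<noteq> [] \<and> hd xs = s \<and> last xs = t \<and> set xs \<subseteq> Y"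
  using assms(1)
proof (induction rule: rtrancl_induct)
  case base
  then show ?case using assms(2,3) by (intro exI[of _ "[s]"]) auto
next
  case (step t' t)
  then obtain xs where xs: "ipath G xs" "xs \<noteq> []" "hd xs = s" "last xs = t'" "set xs \<subseteq> Y"
    by blast
  have t: "t \<in> Y" "adj G t' t" using step.hyps by auto
  have "t' \<in> set xs" using xs last_in_set by blast
  \<comment> \<open>Cutting the path at the first vertex that equals \<open>t\<close> or is adjacent
    to it lets \<open>t\<close> be appended without a chord.\<close>
  then obtain ys x zs where sp: "xs = ys @ x # zs" and x: "x = t \<or> adj G x t"
    and ys: "\<forall>y\<in>set ys. \<not> (y = t \<or> adj G y t)"
    using split_list_first_prop[of xs "\<lambda>x. x = t \<or> adj G x t"] t by blast
  have ip: "ipath G (ys @ [x])" using xs(1) unfolding sp by (auto simp: ipath_append)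
  have hd: "hd (ys @ [x]) = s" using xs(3) unfolding sp by (cases ys) auto
  show ?case
  proof (cases "x = t")
    case True
    then show ?thesis using ip hd xs(5) sp by (intro exI[of _ "ys @ [x]"]) auto
  next
    case False
    have "ipath G ((ys @ [x]) @ [t])"
      unfolding ipath_append[of G "ys @ [x]"] using ip ys x False t assms(3) by (auto simp: ipath_append)
    moreover have "hd ((ys @ [x]) @ [t]) = s" using hd by (cases ys) auto
    moreover have "set ((ys @ [x]) @ [t]) \<subseteq> Y" using xs(5) sp t(1) by auto
    ultimately show ?thesis by (intro exI[of _ "(ys @ [x]) @ [t]"]) simp
  qed
qed

text \<open>An induced path from \<open>s\<close> to \<open>t\<close> inside \<open>Y\<close> closes
  through \<open>u\<close>; it has an inner vertex because \<open>s\<close> and \<open>t\<close> are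
  nonadjacent.\<close>

lemma on_hole_of_connected_set:
  assumes "adj G u s" "adj G u t" "s \<noteq> t" "\<not> adj G s t" "u \<in> verts G" "u \<notin> Y"
    and Y: "connected_set G Y" "s \<in> Y" "t \<in> Y" "Y \<subseteq> verts G"
    and n: "\<And>y. y \<in> Y \<Longrightarrow> y \<noteq> s \<Longrightarrow> y \<noteq> t \<Longrightarrow> \<not> adj G u y"
  shows "on_hole G u s"
proof -
  have "(s, t) \<in> {(a, b). a \<in> Y \<and> b \<in> Y \<and> adj G a b}\<^sup>*"
    using Y unfolding connected_set_def by blast
  from ipath_between[OF this Y(2,4)] obtain xs where
    xs: "ipath G xs" "xs \<noteq> []" "hd xs = s" "last xs = t" "set xs \<subseteq> Y" by blast
  obtain ys where ys: "xs = s # ys" using xs by (cases xs) auto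
  moreover have "ys \<noteq> []" using ys xs assms(3) by auto
  ultimately obtain y zs where yz: "xs = s # y # zs" by (cases ys) auto
  have "zs \<noteq> []" using yz xs assms(4) by auto
  then have "length xs \<ge> 3" unfolding yz by (cases zs) auto
  moreover have "\<forall>y\<in>set xs. adj G u y \<longleftrightarrow> y = hd xs \<or> y = last xs"
    using n assms(1,2) xs(3-5) by blast
  ultimately have "hole_at G u xs"
    unfolding hole_at_def using xs assms(5,6) by blast
  from hole_at_is_hole[OF this] show ?thesis
    unfolding on_hole_def yz by (intro exI) auto
qed

section \<open>Cliques of the chordalized graph\<close>

text \<open>Otherwise open the hole at a nonneighbour \<open>m\<close> of \<open>p\<close>.
  Shortcutting through \<open>p\<close> keeps both edges at \<open>m\<close>, and the new hole
  contains \<open>p\<close>, hence avoids \<open>u\<close>, against the NC property.\<close>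

lemma complete_to_hole:
  assumes nc: "nc_vertex G u" and nh: "\<not> on_hole G u p" and p: "p \<in> verts G" "adj G p u"
    and F: "is_hole G F" "u \<in> F" and v: "v \<in> F" "v \<noteq> u" "\<not> adj G u v" "adj G p v"
    and m: "m \<in> F"
  shows "adj G p m"
proof (rule ccontr)
  assume pm: "\<not> adj G p m"
  obtain ws where ws: "hole_at G m ws" "F = insert m (set ws)" by (rule is_hole_obtain[OF F(1) m])
  have pF: "p \<notin> F" using nh F unfolding on_hole_def by blast
  have um: "u \<noteq> m" "v \<noteq> m" using pm p(2) v(4) by auto
  have "\<exists>ws'. hole_at G m ws' \<and> p \<in> set ws' \<and> set ws' \<subseteq> insert p (set ws) \<and>
    hd ws' = hd ws \<and> last ws' = last ws"
    by (rule hole_shortcut[OF ws(1) p(1) _ _ pm, of u v]) (use pF ws(2) um F v p in auto)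
  then obtain ws' where ws': "hole_at G m ws'" "p \<in> set ws'" "hd ws' = hd ws" "last ws' = last ws"
    by blast
  have F': "is_hole G (insert m (set ws'))" by (rule hole_at_is_hole[OF ws'(1)])
  have uF': "u \<notin> insert m (set ws')"
    using nh F' ws'(2) unfolding on_hole_def by blast
  have ne: "ws \<noteq> []" "ws' \<noteq> []" using ws(1) ws'(1) unfolding hole_at_def by auto
  have "hd ws \<noteq> last ws"
  proof -
    obtain x y zs where "ws = x # y # zs"
      using ws(1) unfolding hole_at_def by (metis (no_types) Suc_le_length_iff numeral_3_eq_3)
    then show ?thesis using ws(1) unfolding hole_at_def by auto
  qed
  moreover have "adj G m (hd ws)" "adj G m (last ws)"
    using ws(1) ne unfolding hole_at_def by auto
  moreover have "adj G (hd ws) m" using calculation adj_sym by metis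
  moreover have "hd ws \<in> F \<inter> insert m (set ws')" "last ws \<in> F \<inter> insert m (set ws')"
    using ne ws(2) ws'(3,4) by (metis Int_iff hd_in_set insertCI, metis Int_iff last_in_set insertCI)
  ultimately show False
    using nc F F' uF' m unfolding nc_vertex_def by blast
qed

lemma nc_vertexD:
  assumes "nc_vertex G u" "is_hole G H" "u \<in> H" "is_hole G H'" "u \<notin> H'" "x \<noteq> z"
    "{x, y, z} \<subseteq> H" "{x, y, z} \<subseteq> H'" "adj G x y" "adj G y z"
  shows False
  using assms unfolding nc_vertex_def by blast

text \<open>The two holes share the whole path \<open>ws\<close>, so two consecutive edges, but only
  one contains \<open>u\<close>.\<close>

lemma nc_replace_vertex:
  assumes nc: "nc_vertex G u" and u: "hole_at G u ws" and v: "hole_at G v ws" and "u \<noteq> v"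
  shows False
proof -
  obtain x y z zs where w: "ws = x # y # z # zs"
    using u unfolding hole_at_def by (metis (no_types) Suc_le_length_iff numeral_3_eq_3)
  have a: "adj G x y" "adj G y z" "x \<noteq> z" "u \<notin> insert v (set ws)"
    using u \<open>u \<noteq> v\<close> unfolding hole_at_def w by auto
  show False
    by (rule nc_vertexD[OF nc hole_at_is_hole[OF u] _ hole_at_is_hole[OF v] a(4,3) _ _ a(1,2)])
      (auto simp: w)
qed


text \<open>Without its last vertex, \<open>ws\<close> is still connected and contains exactly one
  neighbour of \<open>u\<close>; such pieces are glued into a set \<open>Y\<close> for
  \<open>on_hole_of_connected_set\<close>.\<close>

lemma hole_at_butlast:
  assumes "hole_at G u ws"
  shows "hd ws \<in> set (butlast ws)" "connected_set G (set (butlast ws))"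
    "x \<in> set ws \<longleftrightarrow> x = last ws \<or> x \<in> set (butlast ws)" "last ws \<notin> set (butlast ws)"
    "adj G u (hd ws)" "adj G u (last ws)" "set ws \<subseteq> verts G"
proof -
  have ip: "ipath G ws" and l: "length ws \<ge> 3" using assms unfolding hole_at_def by blast+
  have ne: "ws \<noteq> []" using l by auto
  obtain ys z where w: "ws = ys @ [z]" using ne by (cases ws rule: rev_cases) auto
  have "ys \<noteq> []" using l w by auto
  then show "hd ws \<in> set (butlast ws)" "connected_set G (set (butlast ws))"
    "x \<in> set ws \<longleftrightarrow> x = last ws \<or> x \<in> set (butlast ws)" "last ws \<notin> set (butlast ws)"
    using ip unfolding w by (auto simp: ipath_append connected_set_ipath)
  show "adj G u (hd ws)" "adj G u (last ws)"
    using assms ne unfolding hole_at_def by auto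
  show "set ws \<subseteq> verts G" by (rule ipath_verts[OF ip])
qed

text \<open>If \<open>u\<close> misses an end of the opened hole through \<open>v\<close> and
  \<open>w\<close>, this hole and one through \<open>u\<close> and \<open>w\<close> are glued at
  \<open>w\<close> and yield a hole through both \<open>u\<close> and \<open>v\<close>, unless
  \<open>v\<close> has the same neighbours as \<open>u\<close> on the rest of the latter. So in one
  of the two holes \<open>u\<close> and \<open>v\<close> can be exchanged, contrary to
  \<open>nc_replace_vertex\<close>.\<close>

lemma no_common_far_vertex:
  assumes nu: "nc_vertex G u" and nv: "nc_vertex G v" and nh: "\<not> on_hole G u v"
    and uv: "adj G u v" and uw: "on_hole G u w" "\<not> adj G u w" and vw: "on_hole G v w" "\<not> adj G v w"
  shows False
proof -
  have vu: "adj G v u" "\<not> on_hole G v u" "u \<noteq> v"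
    using uv nh by (metis adj_sym, metis on_hole_sym, metis adj_irrefl)
  have wne: "w \<noteq> u" "w \<noteq> v" using vu nh uw(1) vw(1) by auto
  obtain F2 where F2: "is_hole G F2" "v \<in> F2" "w \<in> F2" using vw(1) unfolding on_hole_def by blast
  obtain ws2 where ws2: "hole_at G v ws2" "F2 = insert v (set ws2)"
    by (rule is_hole_obtain[OF F2(1,2)])
  obtain F3 where F3: "is_hole G F3" "u \<in> F3" "w \<in> F3" using uw(1) unfolding on_hole_def by blast
  obtain ws3 where ws3: "hole_at G u ws3" "F3 = insert u (set ws3)"
    by (rule is_hole_obtain[OF F3(1,2)])
  have vs: "u \<in> verts G" "v \<in> verts G" using on_hole_verts uw(1) vw(1) by metis+
  have notin: "u \<notin> F2" "v \<notin> F3" using nh F2 F3 unfolding on_hole_def by blast+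
  \<comment> \<open>By \<open>complete_to_hole\<close>, a neighbour of \<open>u\<close> on
    \<open>F2\<close> that is not adjacent to \<open>v\<close> would make \<open>u\<close> adjacent
    to \<open>w\<close>; \<open>N3\<close> exchanges the roles.\<close>
  have N2: "adj G v x" if "x \<in> F2" "x \<noteq> v" "adj G u x" for x
    using complete_to_hole[OF nv vu(2) vs(1) uv F2(1,2) that(1,2) _ that(3) F2(3)] uw(2) by blast
  have N3: "adj G u x" if "x \<in> F3" "x \<noteq> u" "adj G v x" for x
    using complete_to_hole[OF nu nh vs(2) vu(1) F3(1,2) that(1,2) _ that(3) F3(3)] vw(2) by blast
  have v3: "v \<notin> set ws3" "u \<notin> set ws2" using notin ws3(2) ws2(2) by auto
  \<comment> \<open>Taken for \<open>ws2\<close> and for its reverse, this makes \<open>u\<close>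
    adjacent to both ends.\<close>
  have key: False if ws: "hole_at G v ws" "set ws = set ws2" and uh: "\<not> adj G u (hd ws)" for ws
  proof -
    note B = hole_at_butlast[OF ws(1)]
    define Y2 where "Y2 = insert v (set (butlast ws))"
    have Y2: "connected_set G Y2"
      unfolding Y2_def by (rule connected_set_insert[OF B(2,1,5)])
    have n2: "\<not> adj G u y" if y: "y \<in> set (butlast ws)" for y
    proof
      assume "adj G u y"
      moreover have yw: "y \<in> set ws" using y B(3) by blast
      ultimately have "adj G v y"
        using N2[of y] ws ws2(2) by (metis hole_at_def insertCI)
      then have "y = hd ws" using ws(1) yw y B(4) unfolding hole_at_def by blast
      then show False using uh \<open>adj G u y\<close> by simp
    qed
    have "w \<in> set ws" using F2(3) ws2(2) ws(2) wne by blast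
    moreover have "w \<noteq> last ws" using B(6) vw(2) by metis
    ultimately have w2: "w \<in> Y2" unfolding Y2_def using B(3)[of w] by simp
    have claim: "adj G v (hd vs)" if vs': "hole_at G u vs" "set vs = set ws3" for vs
    proof (rule ccontr)
      assume n: "\<not> adj G v (hd vs)"
      note B' = hole_at_butlast[OF vs'(1)]
      have "w \<noteq> last vs" using B'(6) uw(2) by metis
      then have wv: "w \<in> set (butlast vs)" using F3(3) ws3(2) vs'(2) wne B'(3)[of w] by simp
      \<comment> \<open>The pieces meet in \<open>w\<close>. Besides \<open>v\<close> and
        \<open>hd vs\<close> no vertex of \<open>Y\<close> is adjacent to \<open>u\<close>, so
        nonadjacency of these two would yield a hole through \<open>u\<close> and
        \<open>v\<close>.\<close>
      define Y where "Y = Y2 \<union> set (butlast vs)"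
      have Y: "connected_set G Y"
        unfolding Y_def by (rule connected_set_Un[OF Y2 B'(2) w2 wv])
      have sub: "set (butlast ws) \<subseteq> set ws2" "set (butlast vs) \<subseteq> set ws3"
        using B(3) B'(3) ws(2) vs'(2) by blast+
      have hv: "hd vs \<in> set ws3" using B'(1) sub by blast
      have "u \<notin> set ws3" using ws3(1) unfolding hole_at_def by blast
      then have uY: "u \<notin> Y" unfolding Y_def Y2_def using v3(2) vu(3) sub by blast
      have YV: "Y \<subseteq> verts G"
        unfolding Y_def Y2_def using vs B(3,7) B'(3,7) by blast
      have "\<not> adj G u y" if "y \<in> Y" "y \<noteq> v" "y \<noteq> hd vs" for y
      proof (cases "y \<in> set (butlast vs)")
        case True
        then have "y \<in> set vs" "y \<noteq> last vs" using B'(3,4) by blast+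
        then show ?thesis using vs'(1) that(3) unfolding hole_at_def by blast
      next
        case False
        then show ?thesis using that n2 unfolding Y_def Y2_def by blast
      qed
      moreover have "v \<noteq> hd vs" using hv v3(1) by blast
      moreover have "v \<in> Y" "hd vs \<in> Y" unfolding Y_def Y2_def using B'(1) by blast+
      ultimately have "on_hole G u v"
        using on_hole_of_connected_set[OF uv B'(5) _ n vs(1) uY Y] YV by blast
      then show False using nh by blast
    qed
    have rl: "hd (rev ws3) = last ws3" using ws3(1) unfolding hole_at_def by (auto simp: hd_rev)
    have c: "adj G v (hd ws3)" "adj G v (last ws3)"
      using claim[OF ws3(1)] claim[OF hole_at_rev[OF ws3(1)]] rl by auto
    have "adj G v x \<longleftrightarrow> x = hd ws3 \<or> x = last ws3" if "x \<in> set ws3" for x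
    proof
      assume "adj G v x"
      then have "adj G u x"
        using N3[of x] that ws3 by (metis hole_at_def insertCI)
      then show "x = hd ws3 \<or> x = last ws3" using ws3(1) that unfolding hole_at_def by blast
    qed (use c in auto)
    then have "hole_at G v ws3"
      using ws3(1) v3 vs unfolding hole_at_def by blast
    then show False using nc_replace_vertex[OF nu ws3(1)] vu(3) by blast
  qed
  have ne: "ws2 \<noteq> []" using ws2(1) unfolding hole_at_def by auto
  have "adj G u (hd ws2)" "adj G u (last ws2)"
    using key[OF ws2(1)] key[OF hole_at_rev[OF ws2(1)]] ne by (auto simp: hd_rev)
  moreover have "x = hd ws2 \<or> x = last ws2" if "x \<in> set ws2" "adj G u x" for x
  proof -
    have "adj G v x" using N2[of x] that ws2 by (metis hole_at_def insertCI)
    then show ?thesis using ws2(1) that unfolding hole_at_def by blast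
  qed
  ultimately have "hole_at G u ws2"
    using ws2(1) v3 vs unfolding hole_at_def by blast
  then show False using nc_replace_vertex[OF nu _ ws2(1)] vu(3) by blast
qed

lemma four_cycle_on_hole:
  assumes "{a, b, c, d} \<subseteq> verts G" "adj G a b" "adj G b c" "adj G c d" "adj G d a"
    "\<not> adj G a c" "\<not> adj G b d" "a \<noteq> c" "b \<noteq> d"
  shows "on_hole G a b"
proof -
  have "adj G a d" using assms(5) adj_sym by metis
  moreover have "a \<noteq> b" "b \<noteq> c" "c \<noteq> d" "a \<noteq> d" using assms by auto
  ultimately have "hole_at G a [b, c, d]"
    using assms unfolding hole_at_def by auto
  from hole_at_is_hole[OF this] show ?thesis unfolding on_hole_def by auto
qed

section \<open>Cliques up to one exceptional vertex\<close>

text \<open>\<open>v\<close> need not lie in \<open>K\<close>; if it does not, \<open>K\<close> is a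
  clique of \<open>G\<close>. Keeping a common hole for each missing pair allows the pair to be
  replaced by an arc in a minor.\<close>

definition near_clique :: "'a graph \<Rightarrow> 'a \<Rightarrow> 'a set \<Rightarrow> bool" where
  "near_clique G v K \<longleftrightarrow> K \<subseteq> verts G \<and>
     (\<forall>x\<in>K. \<forall>y\<in>K. x \<noteq> y \<longrightarrow> adj G x y \<or> (x = v \<or> y = v) \<and> on_hole G x y)"

lemma near_cliqueD:
  assumes "near_clique G v K"
  shows "K \<subseteq> verts G"
    "x \<in> K \<Longrightarrow> y \<in> K \<Longrightarrow> x \<noteq> y \<Longrightarrow> adj G x y \<or> (x = v \<or> y = v) \<and> on_hole G x y"
  using assms by (simp_all add: near_clique_def)

lemma clique_hat_near_clique:
  assumes C: "nc_set G C" "finite C" "graph G" and K: "clique (hat G C) K"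
  shows "\<exists>v. near_clique G v K"
proof -
  note hat = hat_props[OF C]
  have KV: "K \<subseteq> verts G" using K hat(2) unfolding clique_def by simp
  have Kadj: "adj G x y \<or> (x \<in> C \<or> y \<in> C) \<and> on_hole G x y" if "x \<in> K" "y \<in> K" "x \<noteq> y" for x y
    using K that hat(4)[of x y] unfolding clique_def by blast
  define new where "new u w \<longleftrightarrow> u \<in> K \<and> w \<in> K \<and> u \<in> C \<and> u \<noteq> w \<and> on_hole G u w \<and> \<not> adj G u w" for u w
  \<comment> \<open>For missing pairs with different ends \<open>u\<close> and \<open>u'\<close> in
    \<open>C\<close>, neither \<open>w\<close> nor \<open>w'\<close> is in \<open>C\<close>;
    \<open>no_common_far_vertex\<close> joins \<open>u\<close> to \<open>w'\<close> and
    \<open>u'\<close> to \<open>w\<close>, and the cycle \<open>u\<close>, \<open>u'\<close>,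
    \<open>w\<close>, \<open>w'\<close> becomes a hole with two vertices of
    \<open>C\<close>.\<close>
  have uniq: "u = u'" if new: "new u w" "new u' w'" for u w u' w'
  proof (rule ccontr)
    assume ne: "u \<noteq> u'"
    have u: "u \<in> K" "w \<in> K" "u \<in> C" "u \<noteq> w" "on_hole G u w" "\<not> adj G u w" and
      u': "u' \<in> K" "w' \<in> K" "u' \<in> C" "u' \<noteq> w'" "on_hole G u' w'" "\<not> adj G u' w'"
      using new unfolding new_def by auto
    have nc: "nc_vertex G u" "nc_vertex G u'" using C(1) u(3) u'(3) unfolding nc_set_def by auto
    have noh: "\<not> on_hole G u u'" using nc_set_unique[OF C(1) _ u(3) u'(3)] ne by blast
    then have noh': "\<not> on_hole G u' u" using on_hole_sym by metis
    have uu: "adj G u u'" using Kadj[OF u(1) u'(1) ne] noh by blast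
    then have uu': "adj G u' u" using adj_sym by metis
    have w: "w \<notin> C" "w' \<notin> C"
      using nc_set_unique[OF C(1) u(5,3)] nc_set_unique[OF C(1) u'(5,3)] u(4) u'(4) by blast+
    have uw': "adj G u w'"
      using Kadj[OF u(1) u'(2)] w(2) u(3) no_common_far_vertex[OF nc noh uu _ _ u'(5,6)] by blast
    have u'w: "adj G u' w"
      using Kadj[OF u'(1) u(2)] w(1) u'(3) no_common_far_vertex[OF nc(2,1) noh' uu' _ _ u(5,6)] by blast
    have ww: "w \<noteq> w'" using uw' u(6) by blast
    then have "adj G w w'" using Kadj[OF u(2) u'(2)] w by blast
    moreover have "adj G w' u" using uw' adj_sym by metis
    ultimately have "on_hole G u u'"
      using four_cycle_on_hole[of u u' w w' G] uu u'w u(4,6) u'(4,6) u(1,2) u'(1,2) KV by auto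
    then show False using noh by blast
  qed
  have sym: "new x y \<or> new y x" if "x \<in> K" "y \<in> K" "x \<noteq> y" "\<not> adj G x y" for x y
    using Kadj[OF that(1-3)] that adj_sym[of G x y] on_hole_sym[of G x y] unfolding new_def by blast
  have "\<exists>v. \<forall>u w. new u w \<longrightarrow> u = v"
    using uniq by blast
  then obtain v where v: "\<And>u w. new u w \<Longrightarrow> u = v" by blast
  have "near_clique G v K"
    unfolding near_clique_def
  proof (intro conjI KV ballI impI)
    fix x y assume xy: "x \<in> K" "y \<in> K" "x \<noteq> y"
    show "adj G x y \<or> (x = v \<or> y = v) \<and> on_hole G x y"
      using sym[OF xy] v Kadj[OF xy] by blast
  qed
  then show ?thesis ..
qed

section \<open>Complete minors\<close>

lemma connected_set_UN:
  assumes "\<And>i. i \<in> I \<Longrightarrow> connected_set G (P i) \<and> v \<in> P i"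
  shows "connected_set G (insert v (\<Union>i\<in>I. P i))"
proof -
  define R where "R S = {(a, b). a \<in> S \<and> b \<in> S \<and> adj G a b}" for S
  let ?U = "insert v (\<Union>i\<in>I. P i)"
  have "(x, v) \<in> (R ?U)\<^sup>* \<and> (v, x) \<in> (R ?U)\<^sup>*" if x: "x \<in> ?U" for x
  proof (cases "x = v")
    case False
    then obtain i where i: "i \<in> I" "x \<in> P i" using x by auto
    have "(R (P i))\<^sup>* \<subseteq> (R ?U)\<^sup>*" using i by (intro rtrancl_mono) (auto simp: R_def)
    moreover have "(x, v) \<in> (R (P i))\<^sup>* \<and> (v, x) \<in> (R (P i))\<^sup>*"
      using assms[OF i(1)] i unfolding connected_set_def R_def by blast
    ultimately show ?thesis by blast
  qed simp
  then show ?thesis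
    unfolding connected_set_def R_def[symmetric] by (blast intro: rtrancl_trans)
qed

text \<open>For a nonneighbour \<open>w\<close>, one of the two arcs of a common hole has no inner
  vertex in \<open>K\<close>: vertices of \<open>K\<close> inside both arcs would be nonadjacent and
  different from \<open>v\<close>.\<close>

lemma near_clique_arc:
  assumes K: "near_clique G v K" and v: "v \<in> K" and w: "w \<in> K" "w \<noteq> v"
  shows "\<exists>P. connected_set G P \<and> v \<in> P \<and> P \<subseteq> verts G \<and> P \<inter> K = {v} \<and> (\<exists>y\<in>P. adj G y w)"
proof (cases "adj G v w")
  case True
  have "v \<in> verts G" using v near_cliqueD(1)[OF K] by blast
  then show ?thesis
    using v True connected_set_singleton[of G v] by (intro exI[of _ "{v}"]) simp
next
  case False
  then have "on_hole G v w" using near_cliqueD(2)[OF K v w(1)] w(2) by blast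
  then obtain F where F: "is_hole G F" "v \<in> F" "w \<in> F" unfolding on_hole_def by blast
  obtain ws where ws: "hole_at G v ws" "F = insert v (set ws)" by (rule is_hole_obtain[OF F(1,2)])
  have "w \<in> set ws" using F ws w by blast
  then obtain as bs where sp: "ws = as @ w # bs" using split_list by fast
  have arc: ?thesis if h: "hole_at G v (as @ w # bs)" and d: "set as \<inter> K = {}" for as bs
  proof -
    have ip: "ipath G (as @ w # bs)"
      and ad: "\<And>y. y \<in> set (as @ w # bs) \<Longrightarrow> adj G v y \<longleftrightarrow> y = hd (as @ w # bs) \<or> y = last (as @ w # bs)"
      using h unfolding hole_at_def by blast+
    have ne: "as \<noteq> []" using ad[of w] False by auto
    have "adj G v (hd as)" using ad[of "hd as"] ne by simp
    moreover have "ipath G as" using ip unfolding ipath_append by blast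
    ultimately have "connected_set G (insert v (set as))"
      using connected_set_insert[OF connected_set_ipath, of G as "hd as" v] ne by simp
    moreover have "insert v (set as) \<subseteq> verts G" using hole_at_subset_verts[OF h] by auto
    moreover have "adj G (last as) w" "last as \<in> set as"
      using ip ne unfolding ipath_append by auto
    ultimately show ?thesis using d v by (intro exI[of _ "insert v (set as)"]) auto
  qed
  have "set as \<inter> K = {} \<or> set (rev bs) \<inter> K = {}"
  proof (rule ccontr)
    assume "\<not> ?thesis"
    then obtain a b where ab: "a \<in> set as" "a \<in> K" "b \<in> set bs" "b \<in> K" by auto
    have "v \<notin> set ws" "ipath G (as @ w # bs)" using ws(1) unfolding sp hole_at_def by blast+
    then have "a \<noteq> v" "b \<noteq> v" "a \<noteq> b" "\<not> adj G a b" using ab unfolding sp ipath_append by auto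
    then show False using near_cliqueD(2)[OF K ab(2,4)] by blast
  qed
  moreover have "hole_at G v (rev bs @ w # rev as)" using hole_at_rev[OF ws(1)] unfolding sp by simp
  ultimately show ?thesis using arc[of as bs] arc[of "rev bs" "rev as"] ws(1) sp by blast
qed

text \<open>The arcs to all other vertices of \<open>K\<close> together form the branch set of
  \<open>v\<close>; the other branch sets are singletons. The arcs may overlap, since they belong to
  the same branch set.\<close>

lemma near_clique_complete_minor:
  assumes K: "near_clique G v K" "finite K" and n: "n \<le> card K"
  shows "has_complete_minor G n"
proof -
  obtain f where f: "bij_betw f {0..<card K} K" using ex_bij_betw_nat_finite[OF K(2)] by blast
  define Q where "Q w P \<longleftrightarrow> connected_set G P \<and> v \<in> P \<and> P \<subseteq> verts G \<and> P \<inter> K = {v} \<and>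
    (\<exists>y\<in>P. adj G y w)" for w P
  define P where "P w = (SOME P. Q w P)" for w
  have "Q w (P w)" if "w \<in> K - {v}" "v \<in> K" for w
    unfolding P_def using near_clique_arc[OF K(1) that(2), of w] that(1)
    by (intro someI_ex[of "Q w"]) (simp add: Q_def)
  then have P: "connected_set G (P w)" "v \<in> P w" "P w \<subseteq> verts G" "P w \<inter> K = {v}"
    "\<exists>y\<in>P w. adj G y w" if "w \<in> K - {v}" "v \<in> K" for w
    using that unfolding Q_def by blast+
  define B where "B x = (if x = v then insert v (\<Union>w\<in>K - {v}. P w) else {x})" for x
  have KV: "K \<subseteq> verts G" using near_cliqueD(1)[OF K(1)] .
  have B1: "B x \<noteq> {} \<and> B x \<subseteq> verts G \<and> connected_set G (B x)" if "x \<in> K" for x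
  proof (cases "x = v")
    case True
    then have "v \<in> K" using that by simp
    then have "connected_set G (insert v (\<Union>w\<in>K - {v}. P w))"
      by (intro connected_set_UN conjI P(1,2))
    moreover have "(\<Union>w\<in>K - {v}. P w) \<subseteq> verts G"
      using P(3) \<open>v \<in> K\<close> by (intro UN_least)
    ultimately show ?thesis unfolding B_def using True KV that by auto
  next
    case False
    then show ?thesis unfolding B_def using KV that by (auto simp: connected_set_singleton)
  qed
  have Bv: "B v \<inter> B x = {} \<and> (\<exists>a\<in>B v. \<exists>b\<in>B x. adj G a b)" if x: "v \<in> K" "x \<in> K" "x \<noteq> v" for x
  proof -
    have xK: "x \<in> K - {v}" using x by blast
    have "x \<notin> P w" if "w \<in> K - {v}" for w using P(4)[OF that x(1)] x by blast
    then have "B v \<inter> B x = {}" unfolding B_def using x(3) by auto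
    moreover obtain y where "y \<in> P x" "adj G y x" using P(5)[OF xK x(1)] by blast
    then have "\<exists>a\<in>B v. \<exists>b\<in>B x. adj G a b" unfolding B_def using x(3) xK by auto
    ultimately show ?thesis by blast
  qed
  have B2: "B x \<inter> B y = {} \<and> (\<exists>a\<in>B x. \<exists>b\<in>B y. adj G a b)" if xy: "x \<in> K" "y \<in> K" "x \<noteq> y" for x y
  proof -
    consider "x = v" | "y = v" | "x \<noteq> v" "y \<noteq> v" by blast
    then show ?thesis
    proof cases
      case 1
      then show ?thesis using Bv xy by blast
    next
      case 2
      then have "B y \<inter> B x = {} \<and> (\<exists>a\<in>B y. \<exists>b\<in>B x. adj G a b)" using Bv xy by blast
      then show ?thesis by (metis adj_sym Int_commute)
    next
      case 3
      then have "adj G x y" using near_cliqueD(2)[OF K(1) xy] by blast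
      then show ?thesis unfolding B_def using 3 xy by auto
    qed
  qed
  have fK: "f i \<in> K" if "i < n" for i
    using f n that unfolding bij_betw_def by auto
  have fi: "f i \<noteq> f j" if "i < n" "j < n" "i \<noteq> j" for i j
    using f n that unfolding bij_betw_def inj_on_def by auto
  show ?thesis
    unfolding has_complete_minor_def
    by (rule exI[of _ "\<lambda>i. B (f i)"]) (use B1 B2 fK fi in simp)
qed


section \<open>The chordalization chain\<close>

lemma verts_delete [simp]: "verts (delete G X) = verts G - X"
  by (auto simp: delete_def induced_def verts_def)

lemma edges_delete: "edges (delete G X) = {e \<in> edges G. e \<subseteq> verts G - X}"
  by (simp add: delete_def induced_def edges_def)

lemma graph_delete:
  assumes "graph G" shows "graph (delete G X)"
proof -
  have "\<exists>u v. u \<noteq> v \<and> u \<in> verts G - X \<and> v \<in> verts G - X \<and> e = {u, v}"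
    if e: "e \<in> edges G" "e \<subseteq> verts G - X" for e
  proof -
    obtain u v where "u \<noteq> v" "e = {u, v}" using assms e(1) unfolding graph_def by blast
    then show ?thesis using e(2) by blast
  qed
  then show ?thesis using assms unfolding graph_def edges_delete verts_delete by simp
qed

lemma adj_delete:
  assumes "graph G"
  shows "adj (delete G X) x y \<longleftrightarrow> adj G x y \<and> x \<notin> X \<and> y \<notin> X"
  using adj_in_verts[OF assms, of x y] unfolding adj_def edges_delete by auto

lemma graph_edge:
  "graph G \<Longrightarrow> e \<in> edges G \<Longrightarrow> \<exists>u v. u \<noteq> v \<and> u \<in> verts G \<and> v \<in> verts G \<and> e = {u, v}"
  by (simp add: graph_def)

text \<open>\<open>D\<close> is the part being added, \<open>X\<close> the union of the later parts,
  \<open>S\<close> the previous chordalized graph. Since \<open>S\<close> already has every edge of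
  \<open>G\<close> between its vertices, edges outside \<open>G\<close> occur only inside
  \<open>S\<close>, and every edge meeting \<open>D\<close> is an edge of \<open>G\<close>.\<close>

lemma chain_step:
  assumes G: "graph G" and S: "graph S" "verts S = verts G - (D \<union> X)"
    "edges (delete G (D \<union> X)) \<subseteq> edges S"
    and D: "D \<subseteq> verts G" "D \<inter> X = {}"
    and Gi: "Gi = (verts S \<union> D, edges S \<union> edges (delete G X))"
  shows "graph Gi" "verts Gi = verts G - X"
    "adj Gi x y \<longleftrightarrow> adj S x y \<or> adj G x y \<and> x \<notin> X \<and> y \<notin> X"
    "x \<in> verts S \<Longrightarrow> y \<in> verts S \<Longrightarrow> adj Gi x y \<longleftrightarrow> adj S x y"
    "x \<notin> verts S \<or> y \<notin> verts S \<Longrightarrow> adj Gi x y \<Longrightarrow> adj G x y"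
proof -
  have v: "verts Gi = verts S \<union> D" and e: "edges Gi = edges S \<union> edges (delete G X)"
    unfolding Gi by (simp_all add: verts_def edges_def)
  show vG: "verts Gi = verts G - X" using v S(2) D by auto
  have "\<exists>u v. u \<noteq> v \<and> u \<in> verts G - X \<and> v \<in> verts G - X \<and> f = {u, v}" if f: "f \<in> edges Gi" for f
  proof -
    consider "f \<in> edges S" | "f \<in> edges (delete G X)" using f unfolding e by blast
    then show ?thesis
    proof cases
      case 1
      from graph_edge[OF S(1) this] show ?thesis by (simp only: S(2)) blast
    next
      case 2
      from graph_edge[OF graph_delete[OF G] this] show ?thesis unfolding verts_delete .
    qed
  qed
  moreover have "finite (verts G - X)" using G by (simp add: graph_def)
  ultimately show "graph Gi" unfolding graph_def vG by simp
  have a: "adj Gi x y \<longleftrightarrow> adj S x y \<or> adj G x y \<and> x \<notin> X \<and> y \<notin> X" for x y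
    unfolding adj_delete[OF G, of X, symmetric] by (auto simp: adj_def e)
  then show "adj Gi x y \<longleftrightarrow> adj S x y \<or> adj G x y \<and> x \<notin> X \<and> y \<notin> X" .
  have "adj S x y" if "adj G x y" "x \<in> verts S" "y \<in> verts S"
  proof -
    have "adj (delete G (D \<union> X)) x y" unfolding adj_delete[OF G] using that S(2) by auto
    then show ?thesis using S(3) unfolding adj_def by blast
  qed
  then show "x \<in> verts S \<Longrightarrow> y \<in> verts S \<Longrightarrow> adj Gi x y \<longleftrightarrow> adj S x y" using a by blast
  show "x \<notin> verts S \<or> y \<notin> verts S \<Longrightarrow> adj Gi x y \<Longrightarrow> adj G x y"
    using a adj_in_verts[OF S(1)] by blast
qed

lemma chain_Suc:
  "fst (chain G Cs (Suc i)) = (verts (snd (chain G Cs i)) \<union> Cs ! i,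
     edges (snd (chain G Cs i)) \<union> edges (delete G (\<Union>(set (drop (Suc i) Cs)))))"
  "snd (chain G Cs (Suc i)) = hat (fst (chain G Cs (Suc i))) (Cs ! i)"
  by (simp_all add: Let_def)

lemma local_chord_partition_parts:
  assumes "local_chord_partition G C Cs" "i < length Cs" "graph G"
  shows "Cs ! i \<subseteq> verts G" "finite (Cs ! i)"
    "Cs ! i \<inter> \<Union>(set (drop (Suc i) Cs)) = {}"
    "\<Union>(set (drop i Cs)) = Cs ! i \<union> \<Union>(set (drop (Suc i) Cs))"
    "nc_set (fst (chain G Cs (Suc i))) (Cs ! i)"
proof -
  have "\<Union>(set Cs) \<subseteq> verts G" using assms(1) unfolding local_chord_partition_def hole_cover_def by blast
  then show s: "Cs ! i \<subseteq> verts G" using assms(2) nth_mem[of i Cs] by blast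
  show "finite (Cs ! i)" using s assms(3) finite_subset unfolding graph_def by blast
  have "Cs ! i \<inter> B = {}" if B: "B \<in> set (drop (Suc i) Cs)" for B
  proof -
    obtain j where j: "j < length (drop (Suc i) Cs)" "B = drop (Suc i) Cs ! j"
      using B unfolding in_set_conv_nth by blast
    then have "B = Cs ! (Suc i + j)" "Suc i + j < length Cs" by auto
    then show ?thesis using assms(1,2) unfolding local_chord_partition_def by auto
  qed
  then show "Cs ! i \<inter> \<Union>(set (drop (Suc i) Cs)) = {}" by blast
  show "\<Union>(set (drop i Cs)) = Cs ! i \<union> \<Union>(set (drop (Suc i) Cs))"
    using Cons_nth_drop_Suc[OF assms(2), symmetric] by simp
  show "nc_set (fst (chain G Cs (Suc i))) (Cs ! i)"
    using assms(1,2) unfolding local_chord_partition_def by blast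
qed

text \<open>Supplies the hypotheses of \<open>chain_step\<close>; \<open>drop i Cs\<close> holds the
  parts not yet added, as \<open>Cs ! i\<close> enters at stage \<open>Suc i\<close>.\<close>

lemma chain_invariant:
  assumes P: "local_chord_partition G C Cs" and G: "graph G" and i: "i \<le> length Cs"
  shows "graph (snd (chain G Cs i)) \<and> verts (snd (chain G Cs i)) = verts G - \<Union>(set (drop i Cs)) \<and>
    edges (delete G (\<Union>(set (drop i Cs)))) \<subseteq> edges (snd (chain G Cs i))"
  using i
proof (induction i)
  case 0
  then show ?case using graph_delete[OF G] by simp
next
  case (Suc i)
  then have "i < length Cs" by simp
  note part = local_chord_partition_parts[OF P this G]
  let ?Gi = "fst (chain G Cs (Suc i))" and ?S = "snd (chain G Cs i)"
  have S: "graph ?S" "verts ?S = verts G - (Cs ! i \<union> \<Union>(set (drop (Suc i) Cs)))"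
    "edges (delete G (Cs ! i \<union> \<Union>(set (drop (Suc i) Cs)))) \<subseteq> edges ?S"
    using Suc.IH Suc.prems unfolding part(4) by auto
  note step = chain_step[OF G S part(1,3) chain_Suc(1)]
  note hat = hat_props[OF part(5,2) step(1)]
  have "edges (delete G (\<Union>(set (drop (Suc i) Cs)))) \<subseteq> edges ?Gi"
    unfolding chain_Suc(1) by (simp add: edges_def)
  then show ?case
    unfolding chain_Suc(2) using hat(1-3) step(2) by blast
qed

text \<open>Every stage costs one vertex, except the first, whose holes are holes of \<open>G\<close>.\<close>

lemma chain_clique_near_clique:
  assumes P: "local_chord_partition G C Cs" and G: "graph G" and i: "i < length Cs"
    and K: "clique (snd (chain G Cs (Suc i))) K"
  shows "\<exists>T v. T \<subseteq> K \<and> card T \<le> i \<and> near_clique G v (K - T)"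
  using i K
proof (induction i arbitrary: K)
  case 0
  note part = local_chord_partition_parts[OF P 0(1) G]
  let ?G1 = "fst (chain G Cs (Suc 0))" and ?S = "snd (chain G Cs 0)"
  let ?X = "\<Union>(set (drop (Suc 0) Cs))"
  have S: "graph ?S" "verts ?S = verts G - (Cs ! 0 \<union> ?X)" "edges (delete G (Cs ! 0 \<union> ?X)) \<subseteq> edges ?S"
    using chain_invariant[OF P G, of 0] unfolding part(4) by auto
  note step = chain_step[OF G S part(1,3) chain_Suc(1)]
  \<comment> \<open>Nothing has been chordalized yet, so the first graph is an induced subgraph of
    \<open>G\<close> and its holes are holes of \<open>G\<close>.\<close>
  have "adj ?S x y \<Longrightarrow> adj G x y \<and> x \<notin> ?X \<and> y \<notin> ?X" for x y
    using part(4) by (auto simp: adj_delete[OF G])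
  then have adj1: "adj ?G1 x y \<longleftrightarrow> adj G x y \<and> x \<notin> ?X \<and> y \<notin> ?X" for x y
    using step(3)[of x y] by blast
  have "is_hole G F" if F: "is_hole ?G1 F" for F
  proof -
    have FV: "F \<subseteq> verts ?G1" using F unfolding is_hole_def by blast
    then have "is_hole ?G1 F \<longleftrightarrow> is_hole G F"
      by (intro is_hole_cong) (use FV step(2) adj1 in auto)
    then show ?thesis using F by blast
  qed
  then have oh: "on_hole ?G1 x y \<Longrightarrow> on_hole G x y" for x y unfolding on_hole_def by blast
  obtain v where v: "near_clique ?G1 v K"
    using clique_hat_near_clique[OF part(5,2) step(1)] 0(2) unfolding chain_Suc(2) by blast
  have "near_clique G v K"
    unfolding near_clique_def
  proof (intro conjI ballI impI)
    show "K \<subseteq> verts G" using near_cliqueD(1)[OF v] step(2) by blast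
    fix x y assume "x \<in> K" "y \<in> K" "x \<noteq> y"
    then show "adj G x y \<or> (x = v \<or> y = v) \<and> on_hole G x y"
      using near_cliqueD(2)[OF v, of x y] adj1[of x y] oh[of x y] by blast
  qed
  then show ?case by (intro exI[of _ "{}"]) auto
next
  case (Suc i)
  note part = local_chord_partition_parts[OF P Suc.prems(1) G]
  let ?Gi = "fst (chain G Cs (Suc (Suc i)))" and ?S = "snd (chain G Cs (Suc i))"
  let ?X = "\<Union>(set (drop (Suc (Suc i)) Cs))"
  have S: "graph ?S" "verts ?S = verts G - (Cs ! Suc i \<union> ?X)"
    "edges (delete G (Cs ! Suc i \<union> ?X)) \<subseteq> edges ?S"
    using chain_invariant[OF P G, of "Suc i"] Suc.prems(1) unfolding part(4) by auto
  note step = chain_step[OF G S part(1,3) chain_Suc(1)]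
  obtain v where v: "near_clique ?Gi v K"
    using clique_hat_near_clique[OF part(5,2) step(1)] Suc.prems(2) unfolding chain_Suc(2) by blast
  have KV: "K \<subseteq> verts G" using near_cliqueD(1)[OF v] step(2) by blast
  \<comment> \<open>Without \<open>v\<close>, all pairs are edges of \<open>?Gi\<close>; the
    vertices in the previous graph form a clique there, to which the induction hypothesis
    applies.\<close>
  have Kv: "adj ?Gi x y" if "x \<in> K - {v}" "y \<in> K - {v}" "x \<noteq> y" for x y
    using near_cliqueD(2)[OF v, of x y] that by blast
  let ?K = "(K - {v}) \<inter> verts ?S"
  have "clique ?S ?K"
    unfolding clique_def using Kv step(4) by blast
  then obtain T v' where T: "T \<subseteq> ?K" "card T \<le> i" "near_clique G v' (?K - T)"
    using Suc.IH Suc.prems(1) by (meson Suc_lessD)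
  \<comment> \<open>\<open>v\<close> may lie outside \<open>K\<close>, hence the
    intersection.\<close>
  let ?T = "insert v T \<inter> K"
  have fin: "finite T" using T(1) KV G unfolding graph_def by (meson finite_subset Int_lower1 Diff_subset)
  have "card ?T \<le> card (insert v T)" using fin by (intro card_mono) auto
  also have "\<dots> \<le> Suc i" using fin T(2) by (simp add: card_insert_if)
  finally have "card ?T \<le> Suc i" .
  moreover have "near_clique G v' (K - ?T)"
    unfolding near_clique_def
  proof (intro conjI ballI impI)
    show "K - ?T \<subseteq> verts G" using KV by blast
    fix x y assume xy: "x \<in> K - ?T" "y \<in> K - ?T" "x \<noteq> y"
    show "adj G x y \<or> (x = v' \<or> y = v') \<and> on_hole G x y"
    proof (cases "x \<in> verts ?S \<and> y \<in> verts ?S")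
      case True
      then show ?thesis using near_cliqueD(2)[OF T(3), of x y] xy by blast
    next
      case False
      \<comment> \<open>With an end outside the previous graph, the edge belongs to
        \<open>G\<close>.\<close>
      have "adj ?Gi x y" using Kv xy by blast
      then show ?thesis using step(5)[of x y] False by blast
    qed
  qed
  ultimately show ?case by (intro exI[of _ ?T] exI[of _ v']) blast
qed

section \<open>Clique numbers\<close>

lemma clique_finite_card:
  assumes "finite (verts G)"
  shows "finite (card ` {K. clique G K})" "{K. clique G K} \<noteq> {}"
proof -
  have "{K. clique G K} \<subseteq> Pow (verts G)" unfolding clique_def by blast
  then show "finite (card ` {K. clique G K})" using assms by (meson finite_Pow_iff finite_imageI finite_subset)
  have "clique G {}" unfolding clique_def by simp
  then show "{K. clique G K} \<noteq> {}" by blast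
qed

lemma card_clique_le_omega:
  assumes "finite (verts G)" "clique G K"
  shows "card K \<le> omega G"
  unfolding omega_def using clique_finite_card[OF assms(1)] assms(2) by (intro Max_ge) auto

lemma omega_le:
  assumes "finite (verts G)" "\<And>K. clique G K \<Longrightarrow> card K \<le> m"
  shows "omega G \<le> m"
  unfolding omega_def using clique_finite_card[OF assms(1)] assms(2) by (subst Max_le_iff) auto

lemma clique_induced: "clique (induced G S) K \<longleftrightarrow> clique G K \<and> K \<subseteq> S"
proof -
  have v: "verts (induced G S) = verts G \<inter> S"
    and a: "adj (induced G S) x y \<longleftrightarrow> adj G x y \<and> x \<in> S \<and> y \<in> S" for x y
    by (auto simp: induced_def verts_def edges_def adj_def)
  show ?thesis unfolding clique_def v a by (auto simp: subset_iff)
qed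

text \<open>Deleting \<open>v\<close> leaves a clique of \<open>G\<close>.\<close>

lemma near_clique_card_le:
  assumes G: "graph G" and K: "near_clique G v K" and S: "K \<subseteq> S"
  shows "card K \<le> Suc (omega (induced G S))"
proof -
  have fin: "finite (verts (induced G S))" using G by (simp add: graph_def induced_def verts_def)
  have "clique G (K - {v})"
    unfolding clique_def using near_cliqueD[OF K] by blast
  then have "clique (induced G S) (K - {v})" unfolding clique_induced using S by blast
  from card_clique_le_omega[OF fin this] have "card (K - {v}) \<le> omega (induced G S)" .
  moreover have "card K \<le> Suc (card (K - {v}))" by (auto simp: card_Diff_singleton_if)
  ultimately show ?thesis by simp
qed

section \<open>The two bounds on the clique number\<close>

theorem theorem4p4:
  fixes G :: "'a graph" and C :: "'a set" and Cs :: "'a set list" and n :: nat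
  assumes "graph G"
    and "\<not> chordal G \<Longrightarrow> local_chord_partition G C Cs \<and> length Cs = nci G"
  defines "Gs \<equiv> (if chordal G then G else snd (chain G Cs (length Cs)))"
  shows "(\<forall>S \<subseteq> verts G. omega (induced Gs S) \<le> omega (induced G S) + nci G) \<and>
         (\<not> chordal G \<and> \<not> has_complete_minor G n \<longrightarrow> omega Gs \<le> n - 2 + nci G)"
proof (cases "chordal G")
  case True
  then show ?thesis unfolding Gs_def by simp
next
  case False
  note G = assms(1)
  have P: "local_chord_partition G C Cs" and len: "length Cs = nci G" using assms(2) False by auto
  \<comment> \<open>A hole cover is nonempty, so there is a first stage; \<open>l\<close> is the
    index minus one and counts the later stages.\<close>
  have "Cs \<noteq> []" using P unfolding local_chord_partition_def hole_cover_def by auto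
  then obtain l where l: "length Cs = Suc l" by (cases Cs) auto
  then have l_less: "l < length Cs" by simp
  have Gs: "Gs = snd (chain G Cs (Suc l))" unfolding Gs_def l using False by simp
  have gGs: "graph Gs"
    using chain_invariant[OF P G, of "Suc l"] l unfolding Gs by auto
  have fin: "finite (verts G)" "finite (verts Gs)" using G gGs unfolding graph_def by blast+
  have split: "\<exists>K' v. K' \<subseteq> K \<and> card K \<le> card K' + l \<and> near_clique G v K'" if K: "clique Gs K" for K
  proof -
    obtain T v where T: "T \<subseteq> K" "card T \<le> l" "near_clique G v (K - T)"
      using chain_clique_near_clique[OF P G l_less] K unfolding Gs by blast
    have "finite K" using K fin(2) finite_subset unfolding clique_def by blast
    then have "card K \<le> card (K - T) + l"
      using T(1,2) card_Diff_subset[of T K] finite_subset[of T K] card_mono[of K T] by simp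
    then show ?thesis using T(3) by blast
  qed
  have "omega (induced Gs S) \<le> omega (induced G S) + nci G" for S
  proof (rule omega_le)
    show "finite (verts (induced Gs S))" using fin(2) by (simp add: induced_def verts_def)
    fix K assume "clique (induced Gs S) K"
    then have K: "clique Gs K" "K \<subseteq> S" unfolding clique_induced by auto
    obtain K' v where K': "K' \<subseteq> K" "card K \<le> card K' + l" "near_clique G v K'" using split[OF K(1)] by blast
    have "card K' \<le> Suc (omega (induced G S))"
      using near_clique_card_le[OF G K'(3)] K'(1) K(2) by blast
    \<comment> \<open>At most \<open>l\<close> deleted vertices and the exceptional vertex
      \<open>v\<close> add up to \<open>nci G\<close>.\<close>
    then show "card K \<le> omega (induced G S) + nci G" using K'(2) l len by simp
  qed
  moreover have "omega Gs \<le> n - 2 + nci G" if n: "\<not> has_complete_minor G n"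
  proof (rule omega_le[OF fin(2)])
    fix K assume K: "clique Gs K"
    obtain K' v where K': "K' \<subseteq> K" "card K \<le> card K' + l" "near_clique G v K'" using split[OF K] by blast
    have "finite K'" using near_cliqueD(1)[OF K'(3)] fin(1) finite_subset by blast
    then have "card K' < n" using near_clique_complete_minor[OF K'(3)] n by (meson not_le)
    \<comment> \<open>Uses \<open>nci G = Suc l\<close>. For \<open>n = 1\<close> the truncated
      \<open>n - 2\<close> is 0 and \<open>K'\<close> is empty; \<open>n = 0\<close> is ruled out by
      \<open>card K' < n\<close>.\<close>
    then show "card K \<le> n - 2 + nci G" using K'(2) l len by linarith
  qed
  ultimately show ?thesis by blast
qed

end
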